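(* Let $2\le Q\le7$ be an integer and let $\lambda>\lambda_*:=\frac{3-\sqrt5}{2}Q+\sqrt5$. Then $$R_{A_{\mathbb H^Q}}(\lambda)=R_{A_{\mathbb G^Q}}(\lambda)\Big[\mathbf 1_{\ell^2(\mathbb G^Q)}+P_{\ell^2(\mathbb N)}\Big(\mathbf 1_{\ell^2(\mathbb N)}-\tfrac1\lambda W\big(\tfrac1\lambda\big)\Big)^{-1}P_{\ell^2(\mathbb N)}R_{A_{\mathbb G^Q}}(\lambda)\Big],$$ where $W(\xi)$ is the operator acting on $\ell^2(\mathbb N)$ whose matrix elements are, for $x,y\in\mathbb N\subset\mathbb G^Q$, $$W_{x,y}(\xi)=\bigg(\frac{1-\sqrt{1-4(Q-1)\xi^2}}{2(Q-1)\xi}\bigg)^{d(x,y)}\frac{2(Q-1)}{Q-2+Q\sqrt{1-4(Q-1)\xi^2}}.$$ In addition, $\mathbb H^Q$ is transient.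
   Context: For a graph $X$ (undirected, self-loops allowed) the adjacency operator $A_X$ acts on $\ell^2(VX)$ and its matrix entry $A_{xy}$ is the number of edges joining $x$ and $y$; a single self-loop at $x$ contributes $A_{xx}=1$. $\mathbb G^Q$ is the homogeneous Cayley tree of order $Q$ (the infinite tree in which every vertex has degree $Q$), with a fixed root $0$ and graph distance $d$. $\mathbb H^Q$ is the graph obtained from $\mathbb G^Q$ by adding one self-loop at each vertex of a fixed one-sided infinite path (without repeated vertices) starting from the root $0$; this path is denoted by $\mathbb N\subset\mathbb G^Q$, and $P_{\ell^2(\mathbb N)}$ is the orthogonal projection of $\ell^2(\mathbb G^Q)$ onto $\ell^2(\mathbb N)$. $R_B(\lambda)=(\lambda\mathbf 1-B)^{-1}$ is the resolvent. A connected graph with bounded selfadjoint adjacency $A$ is called recurrent if $\lim_{\lambda\downarrow\|A\|}\langle R_A(\lambda)\delta_x,\delta_x\rangle=+\infty$ for a vertex $x$ (the property does not depend on $x$), and transient otherwise. *)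

theory Defs
  imports "HOL-Analysis.Analysis"
begin

section \<open>The Hilbert space of square-summable functions\<close>

typedef 'a ell2 = "{f :: 'a \<Rightarrow> complex. (\<lambda>x. (cmod (f x))\<^sup>2) summable_on UNIV}"
  morphisms coord Abs_ell2
  by (rule exI[of _ "\<lambda>_. 0"]) simp

setup_lifting type_definition_ell2

lemma coord_summable: "(\<lambda>x. (cmod (coord f x))\<^sup>2) summable_on UNIV"
  using coord[of f] by simp

lemma ell2_eqI: "(\<And>x. coord f x = coord g x) \<Longrightarrow> f = g"
  by (metis coord_inject ext)

lemma cmod_add_square_le: "(cmod (a + b))\<^sup>2 \<le> 2 * (cmod a)\<^sup>2 + 2 * (cmod b)\<^sup>2"
proof -
  have "(cmod (a + b))\<^sup>2 \<le> (cmod a + cmod b)\<^sup>2"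
    by (intro power_mono norm_triangle_ineq) simp
  also have "\<dots> \<le> 2 * (cmod a)\<^sup>2 + 2 * (cmod b)\<^sup>2"
    using sum_squares_bound[of "cmod a" "cmod b"] by (simp add: power2_sum)
  finally show ?thesis .
qed

lemma square_summable_add:
  assumes "(\<lambda>x. (cmod (f x))\<^sup>2) summable_on A" "(\<lambda>x. (cmod (g x))\<^sup>2) summable_on A"
  shows "(\<lambda>x. (cmod (f x + g x))\<^sup>2) summable_on A"
proof (rule summable_on_comparison_test)
  show "(\<lambda>x. 2 * (cmod (f x))\<^sup>2 + 2 * (cmod (g x))\<^sup>2) summable_on A"
    by (intro summable_on_add summable_on_cmult_right assms)
qed (auto intro: cmod_add_square_le)

lemma square_summable_scale:
  assumes "(\<lambda>x. (cmod (f x))\<^sup>2) summable_on A"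
  shows "(\<lambda>x. (cmod (c * f x))\<^sup>2) summable_on A"
  using summable_on_cmult_right[OF assms, of "(cmod c)\<^sup>2"]
  by (simp add: norm_mult power_mult_distrib)

lift_definition scaleC :: "complex \<Rightarrow> 'a ell2 \<Rightarrow> 'a ell2" (infixr \<open>*\<^sub>C\<close> 75)
  is "\<lambda>c f x. c * f x"
  by (simp add: square_summable_scale)

definition cinner :: "'a ell2 \<Rightarrow> 'a ell2 \<Rightarrow> complex" where
  "cinner f g = (\<Sum>\<^sub>\<infinity>x. cnj (coord f x) * coord g x)"

lemma cinner_summable: "(\<lambda>x. cnj (coord f x) * coord g x) summable_on UNIV"
proof (rule abs_summable_summable, rule summable_on_comparison_test)
  show "(\<lambda>x. (cmod (coord f x))\<^sup>2 + (cmod (coord g x))\<^sup>2) summable_on UNIV"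
    by (intro summable_on_add coord_summable)
  fix x
  have "0 \<le> cmod (coord f x) * cmod (coord g x)" by simp
  then show "cmod (cnj (coord f x) * coord g x) \<le> (cmod (coord f x))\<^sup>2 + (cmod (coord g x))\<^sup>2"
    using sum_squares_bound[of "cmod (coord f x)" "cmod (coord g x)"]
    unfolding norm_mult complex_mod_cnj by linarith
qed simp

instantiation ell2 :: (type) real_inner
begin

lift_definition zero_ell2 :: "'a ell2" is "\<lambda>_. 0" by simp

lift_definition plus_ell2 :: "'a ell2 \<Rightarrow> 'a ell2 \<Rightarrow> 'a ell2" is "\<lambda>f g x. f x + g x"
  by (simp add: square_summable_add)

lift_definition uminus_ell2 :: "'a ell2 \<Rightarrow> 'a ell2" is "\<lambda>f x. - f x" by simp

lift_definition minus_ell2 :: "'a ell2 \<Rightarrow> 'a ell2 \<Rightarrow> 'a ell2" is "\<lambda>f g x. f x - g x"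
  using square_summable_add[where g = "\<lambda>x. - g x" for g] by force

lift_definition scaleR_ell2 :: "real \<Rightarrow> 'a ell2 \<Rightarrow> 'a ell2" is "\<lambda>r f x. complex_of_real r * f x"
  by (simp add: square_summable_scale)

definition inner_ell2 :: "'a ell2 \<Rightarrow> 'a ell2 \<Rightarrow> real" where
  "inner_ell2 f g = Re (cinner f g)"

definition norm_ell2 :: "'a ell2 \<Rightarrow> real" where
  "norm_ell2 f = sqrt (\<Sum>\<^sub>\<infinity>x. (cmod (coord f x))\<^sup>2)"

definition dist_ell2 :: "'a ell2 \<Rightarrow> 'a ell2 \<Rightarrow> real" where
  "dist_ell2 f g = norm (f - g)"

definition sgn_ell2 :: "'a ell2 \<Rightarrow> 'a ell2" where
  "sgn_ell2 f = inverse (norm f) *\<^sub>R f"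

definition uniformity_ell2 :: "('a ell2 \<times> 'a ell2) filter" where
  "uniformity_ell2 = (INF e\<in>{0<..}. principal {(f, g). dist f g < e})"

definition open_ell2 :: "'a ell2 set \<Rightarrow> bool" where
  "open_ell2 U \<longleftrightarrow> (\<forall>f\<in>U. \<forall>\<^sub>F (f', g) in uniformity. f' = f \<longrightarrow> g \<in> U)"

instance
proof
  fix f g h :: "'a ell2" and r s :: real
  show "f + g + h = f + (g + h)" by transfer (simp add: add.assoc)
  show "f + g = g + f" by transfer (simp add: add.commute)
  show "0 + f = f" by transfer simp
  show "- f + f = 0" by transfer simp
  show "f - g = f + - g" by transfer simp
  show "r *\<^sub>R (f + g) = r *\<^sub>R f + r *\<^sub>R g" by transfer (simp add: distrib_left)
  show "(r + s) *\<^sub>R f = r *\<^sub>R f + s *\<^sub>R f" by transfer (simp add: distrib_right)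
  show "r *\<^sub>R s *\<^sub>R f = (r * s) *\<^sub>R f" by transfer (simp add: mult.assoc)
  show "1 *\<^sub>R f = f" by transfer simp
  show "dist f g = norm (f - g)" by (simp add: dist_ell2_def)
  show "sgn f = inverse (norm f) *\<^sub>R f" by (simp only: sgn_ell2_def)
  show "(uniformity :: ('a ell2 \<times> 'a ell2) filter) =
      (INF e\<in>{0<..}. principal {(f, g). dist f g < e})"
    by (simp add: uniformity_ell2_def)
  show "open U \<longleftrightarrow> (\<forall>f\<in>U. \<forall>\<^sub>F (f', g) in uniformity. f' = f \<longrightarrow> g \<in> U)" for U :: "'a ell2 set"
    by (simp add: open_ell2_def)
  have Re_inner: "inner f g = (\<Sum>\<^sub>\<infinity>x. Re (cnj (coord f x) * coord g x))" for f g :: "'a ell2"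
    unfolding inner_ell2_def cinner_def by (rule infsum_Re[OF cinner_summable, symmetric])
  have Re_summable: "(\<lambda>x. Re (cnj (coord f x) * coord g x)) summable_on UNIV" for f g :: "'a ell2"
    by (rule summable_on_Re[OF cinner_summable])
  have inner_self: "inner f f = (\<Sum>\<^sub>\<infinity>x. (cmod (coord f x))\<^sup>2)" for f :: "'a ell2"
    unfolding Re_inner cmod_power2 by (simp add: power2_eq_square)
  show "inner f g = inner g f"
    unfolding Re_inner by (simp add: mult.commute)
  show "inner (f + g) h = inner f h + inner g h"
    unfolding Re_inner infsum_add[OF Re_summable Re_summable, symmetric]
    by (simp add: plus_ell2.rep_eq algebra_simps)
  show "inner (r *\<^sub>R f) g = r * inner f g"
    unfolding Re_inner infsum_cmult_right'[symmetric]
    by (simp add: scaleR_ell2.rep_eq algebra_simps)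
  show "0 \<le> inner f f"
    unfolding inner_self by (rule infsum_nonneg) simp
  show "inner f f = 0 \<longleftrightarrow> f = 0"
  proof
    assume "inner f f = 0"
    then have "(cmod (coord f x))\<^sup>2 = 0" for x
      unfolding inner_self by (rule nonneg_infsum_le_0D[OF eq_refl coord_summable]) auto
    then show "f = 0" by (intro ell2_eqI) (simp add: zero_ell2.rep_eq)
  next
    assume "f = 0"
    then show "inner f f = 0" by (simp add: Re_inner zero_ell2.rep_eq)
  qed
  show "norm f = sqrt (inner f f)"
    by (simp add: norm_ell2_def inner_self)
qed

end

lift_definition delta :: "'a \<Rightarrow> 'a ell2" is "\<lambda>a x. if x = a then 1 else 0"
proof -
  fix a :: 'a
  have "(\<lambda>x. (cmod (if x = a then 1 else 0))\<^sup>2) summable_on {a}" by simp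
  then show "(\<lambda>x. (cmod (if x = a then 1 else 0))\<^sup>2) summable_on UNIV"
    by (rule summable_on_cong_neutral[THEN iffD1, rotated -1]) auto
qed

text \<open>For \<open>S \<subseteq> V\<close>, the space of square-summable functions on \<open>S\<close> is identified with the
  closed subspace of those functions on \<open>V\<close> that vanish outside \<open>S\<close>.\<close>

definition ell2_on :: "'a set \<Rightarrow> 'a ell2 set" where
  "ell2_on S = {f. \<forall>x. x \<notin> S \<longrightarrow> coord f x = 0}"

lemma ell2_on_UNIV [simp]: "ell2_on UNIV = UNIV"
  by (simp add: ell2_on_def)

definition orthogonal_projection :: "'a ell2 set \<Rightarrow> 'a ell2 \<Rightarrow> 'a ell2" where
  "orthogonal_projection M f = (THE g. g \<in> M \<and> (\<forall>h\<in>M. cinner h (f - g) = 0))"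

lemma coord_orthogonal_projection_ell2_on:
  "coord (orthogonal_projection (ell2_on S) f) x = (if x \<in> S then coord f x else 0)"
proof -
  define g where "g = Abs_ell2 (\<lambda>x. if x \<in> S then coord f x else 0)"
  have "(\<lambda>x. (cmod (if x \<in> S then coord f x else 0))\<^sup>2) summable_on UNIV"
    by (rule summable_on_comparison_test[OF coord_summable[of f]]) auto
  then have g: "coord g = (\<lambda>x. if x \<in> S then coord f x else 0)"
    unfolding g_def by (intro Abs_ell2_inverse) simp
  have "orthogonal_projection (ell2_on S) f = g"
    unfolding orthogonal_projection_def
  proof (rule the_equality)
    show "g \<in> ell2_on S \<and> (\<forall>h\<in>ell2_on S. cinner h (f - g) = 0)"
      by (auto simp: ell2_on_def g cinner_def minus_ell2.rep_eq intro!: infsum_0)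
  next
    fix g' assume g': "g' \<in> ell2_on S \<and> (\<forall>h\<in>ell2_on S. cinner h (f - g') = 0)"
    have "coord g' a = coord g a" for a
    proof (cases "a \<in> S")
      case True
      then have "delta a \<in> ell2_on S" by (auto simp: ell2_on_def delta.rep_eq)
      with g' have "cinner (delta a) (f - g') = 0" by blast
      moreover have "cinner (delta a) (f - g') = (\<Sum>\<^sub>\<infinity>x\<in>{a}. coord (f - g') x)"
        unfolding cinner_def by (rule infsum_cong_neutral) (auto simp: delta.rep_eq)
      ultimately show ?thesis using True by (simp add: g minus_ell2.rep_eq)
    next
      case False
      then show ?thesis using g' by (simp add: ell2_on_def g)
    qed
    then show "g' = g" by (rule ell2_eqI)
  qed
  then show ?thesis by (simp add: g)
qed


section \<open>Bounded operators on subspaces\<close>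

text \<open>An operator on a subspace \<open>M\<close> is a function on the whole type of which only the values on
  \<open>M\<close> matter.  Linearity is over the complex numbers.\<close>

definition bounded_operator_on :: "'a ell2 set \<Rightarrow> ('a ell2 \<Rightarrow> 'a ell2) \<Rightarrow> bool" where
  "bounded_operator_on M T \<longleftrightarrow>
     (\<forall>f\<in>M. T f \<in> M) \<and>
     (\<forall>f\<in>M. \<forall>g\<in>M. T (f + g) = T f + T g) \<and>
     (\<forall>c. \<forall>f\<in>M. T (c *\<^sub>C f) = c *\<^sub>C T f) \<and>
     (\<exists>K. \<forall>f\<in>M. norm (T f) \<le> K * norm f)"

definition invertible_on :: "'a ell2 set \<Rightarrow> ('a ell2 \<Rightarrow> 'a ell2) \<Rightarrow> bool" where
  "invertible_on M T \<longleftrightarrow> bounded_operator_on M T \<and>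
     (\<exists>S. bounded_operator_on M S \<and> (\<forall>f\<in>M. S (T f) = f \<and> T (S f) = f))"

definition in_resolvent_set :: "('a ell2 \<Rightarrow> 'a ell2) \<Rightarrow> complex \<Rightarrow> bool" where
  "in_resolvent_set A z \<longleftrightarrow> invertible_on UNIV (\<lambda>f. z *\<^sub>C f - A f)"

definition resolvent :: "('a ell2 \<Rightarrow> 'a ell2) \<Rightarrow> complex \<Rightarrow> 'a ell2 \<Rightarrow> 'a ell2" where
  "resolvent A z = inv (\<lambda>f. z *\<^sub>C f - A f)"

definition bounded_selfadjoint :: "('a ell2 \<Rightarrow> 'a ell2) \<Rightarrow> bool" where
  "bounded_selfadjoint A \<longleftrightarrow>
     bounded_operator_on UNIV A \<and> (\<forall>f g. cinner (A f) g = cinner f (A g))"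

text \<open>The operator on \<^term>\<open>ell2_on S\<close> with the given matrix.  It is meaningful only if the image
  functions are square-summable; \<open>has_matrix\<close> records that an operator is bounded and has the
  prescribed matrix elements.\<close>

definition matrix_operator :: "'a set \<Rightarrow> ('a \<Rightarrow> 'a \<Rightarrow> complex) \<Rightarrow> 'a ell2 \<Rightarrow> 'a ell2" where
  "matrix_operator S a f = Abs_ell2 (\<lambda>x. if x \<in> S then \<Sum>\<^sub>\<infinity>y\<in>S. a x y * coord f y else 0)"

definition has_matrix :: "'a set \<Rightarrow> ('a ell2 \<Rightarrow> 'a ell2) \<Rightarrow> ('a \<Rightarrow> 'a \<Rightarrow> complex) \<Rightarrow> bool" where
  "has_matrix S T a \<longleftrightarrow> bounded_operator_on (ell2_on S) T \<and>
     (\<forall>x\<in>S. \<forall>y\<in>S. cinner (delta x) (T (delta y)) = a x y)"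


section \<open>Graphs\<close>

text \<open>Undirected graphs whose vertex set is the type \<open>'v\<close>.  An edge with a single end is a
  self-loop; parallel edges are allowed.\<close>

record ('v, 'e) graph =
  edges :: "'e set"
  ends :: "'e \<Rightarrow> 'v set"

definition valid_graph :: "('v, 'e) graph \<Rightarrow> bool" where
  "valid_graph X \<longleftrightarrow> (\<forall>e\<in>edges X. card (ends X e) = 1 \<or> card (ends X e) = 2)"

definition edge_count :: "('v, 'e) graph \<Rightarrow> 'v \<Rightarrow> 'v \<Rightarrow> nat" where
  "edge_count X x y = card {e \<in> edges X. ends X e = {x, y}}"

definition adjacency_operator :: "('v, 'e) graph \<Rightarrow> 'v ell2 \<Rightarrow> 'v ell2" where
  "adjacency_operator X = matrix_operator UNIV (\<lambda>x y. of_nat (edge_count X x y))"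

definition adjacent :: "('v, 'e) graph \<Rightarrow> 'v \<Rightarrow> 'v \<Rightarrow> bool" where
  "adjacent X x y \<longleftrightarrow> (\<exists>e\<in>edges X. ends X e = {x, y})"

definition walk_betw :: "('v, 'e) graph \<Rightarrow> 'v \<Rightarrow> 'v list \<Rightarrow> 'v \<Rightarrow> bool" where
  "walk_betw X x w y \<longleftrightarrow> w \<noteq> [] \<and> hd w = x \<and> last w = y \<and> successively (adjacent X) w"

definition graph_connected :: "('v, 'e) graph \<Rightarrow> bool" where
  "graph_connected X \<longleftrightarrow> (\<forall>x y. \<exists>w. walk_betw X x w y)"

definition graph_dist :: "('v, 'e) graph \<Rightarrow> 'v \<Rightarrow> 'v \<Rightarrow> nat" where
  "graph_dist X x y = (LEAST n. \<exists>w. walk_betw X x w y \<and> length w = Suc n)"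

text \<open>Self-loops are cycles of length one, pairs of parallel edges are cycles of length two.\<close>

definition is_cycle :: "('v, 'e) graph \<Rightarrow> 'v list \<Rightarrow> 'e list \<Rightarrow> bool" where
  "is_cycle X vs es \<longleftrightarrow>
     es \<noteq> [] \<and> length vs = length es \<and> distinct vs \<and> distinct es \<and> set es \<subseteq> edges X \<and>
     (\<forall>i<length es. ends X (es ! i) = {vs ! i, vs ! (Suc i mod length vs)})"

definition vertex_degree :: "('v, 'e) graph \<Rightarrow> 'v \<Rightarrow> nat" where
  "vertex_degree X x = card {e \<in> edges X. x \<in> ends X e}"

definition homogeneous_tree :: "nat \<Rightarrow> ('v, 'e) graph \<Rightarrow> bool" where
  "homogeneous_tree Q X \<longleftrightarrow>
     valid_graph X \<and> graph_connected X \<and> (\<nexists>vs es. is_cycle X vs es) \<and>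
     infinite (UNIV :: 'v set) \<and> (\<forall>x. vertex_degree X x = Q)"

definition infinite_path_from :: "('v, 'e) graph \<Rightarrow> 'v \<Rightarrow> (nat \<Rightarrow> 'v) \<Rightarrow> bool" where
  "infinite_path_from X r p \<longleftrightarrow> p 0 = r \<and> inj p \<and> (\<forall>n. adjacent X (p n) (p (Suc n)))"

definition add_loops :: "('v, 'e) graph \<Rightarrow> 'v set \<Rightarrow> ('v, 'e + 'v) graph" where
  "add_loops X N = \<lparr>edges = edges X <+> N, ends = case_sum (ends X) (\<lambda>x. {x})\<rparr>"

text \<open>For \<open>\<lambda> > \<parallel>A\<parallel>\<close> the diagonal elements of the resolvent of a selfadjoint operator are real,
  so taking the real part only changes the type.\<close>

definition recurrent :: "('v, 'e) graph \<Rightarrow> bool" where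
  "recurrent X \<longleftrightarrow>
     (let A = adjacency_operator X in
      valid_graph X \<and> graph_connected X \<and> bounded_selfadjoint A \<and>
      (\<exists>x. filterlim (\<lambda>l. Re (cinner (resolvent A (complex_of_real l) (delta x)) (delta x)))
             at_top (at_right (onorm A))))"

definition transient :: "('v, 'e) graph \<Rightarrow> bool" where
  "transient X \<longleftrightarrow>
     valid_graph X \<and> graph_connected X \<and> bounded_selfadjoint (adjacency_operator X) \<and>
     \<not> recurrent X"


section \<open>The operator \<open>W\<close>\<close>

definition W_entry :: "nat \<Rightarrow> real \<Rightarrow> nat \<Rightarrow> real" where
  "W_entry Q \<xi> d =
     ((1 - sqrt (1 - 4 * (real Q - 1) * \<xi>\<^sup>2)) / (2 * (real Q - 1) * \<xi>)) ^ d *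
     (2 * (real Q - 1) / (real Q - 2 + real Q * sqrt (1 - 4 * (real Q - 1) * \<xi>\<^sup>2)))"

definition W_matrix :: "nat \<Rightarrow> ('v, 'e) graph \<Rightarrow> real \<Rightarrow> 'v \<Rightarrow> 'v \<Rightarrow> complex" where
  "W_matrix Q X \<xi> x y = complex_of_real (W_entry Q \<xi> (graph_dist X x y))"

definition W_operator :: "nat \<Rightarrow> ('v, 'e) graph \<Rightarrow> 'v set \<Rightarrow> real \<Rightarrow> 'v ell2 \<Rightarrow> 'v ell2" where
  "W_operator Q X N \<xi> = matrix_operator N (W_matrix Q X \<xi>)"

end

theory Submission
  imports Defs
begin

text \<open>Let \<open>q = Q - 1\<close>.  For \<open>0 < a < 1\<close> with \<open>q a\<^sup>2 < 1\<close>, the function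
  \<open>x \<mapsto> a / (1 - a\<^sup>2) \<cdot> a ^ d(x, y)\<close> is square-summable and solves \<open>(\<lambda> - A\<^sub>G) V = \<delta>\<^sub>y\<close> for
  \<open>\<lambda> = 1 / a + q a\<close>, so that \<open>W / \<lambda>\<close> is the compression of the resolvent of \<open>A\<^sub>G\<close> to the path and the
  formula is Krein's.  The critical \<open>\<lambda>\<^sub>*\<close> belongs to \<open>a = (3 - \<surd>5) / 2\<close>, for which \<open>q a\<^sup>2 < 1\<close>
  amounts to \<open>Q \<le> 7\<close>.  Summing these functions over all \<open>y\<close> on the path yields a bounded positive
  \<open>h\<close> with \<open>(\<lambda>\<^sub>* - A\<^sub>G) h = 1\<close> on the path and \<open>0\<close> elsewhere, and \<open>h < 1\<close> on the path.  Hence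
  \<open>A\<^sub>H h \<le> \<lambda>\<^sub>* h\<close>, and Schur's test bounds the norm of \<open>A\<^sub>H\<close> by \<open>\<lambda>\<^sub>*\<close>.  The partial sums of \<open>h\<close> show
  that the norm is exactly \<open>\<lambda>\<^sub>*\<close>.  Finally \<open>(\<lambda>\<^sub>* - A\<^sub>H) h\<close> is strictly positive at the root, so a
  multiple of \<open>h\<close> dominates \<open>R(\<lambda>) \<delta>\<^sub>r\<close> for every \<open>\<lambda> > \<lambda>\<^sub>*\<close>; applying powers of \<open>A\<^sub>H\<close> carries this
  to the other vertices.\<close>

section \<open>Square-summable functions\<close>

lemma ell2_finite_sum_le: "finite F \<Longrightarrow> (\<Sum>x\<in>F. (cmod (coord f x))\<^sup>2) \<le> (norm f)\<^sup>2"
  unfolding norm_ell2_def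
  by (simp add: infsum_nonneg finite_sum_le_infsum[OF coord_summable])

lemma cmod_coord_le: "cmod (coord f x) \<le> norm f"
  using ell2_finite_sum_le[of "{x}" f] by (simp add: power2_le_iff_abs_le)

lemma square_summableI:
  assumes "\<And>F. finite F \<Longrightarrow> (\<Sum>x\<in>F. (cmod (g x))\<^sup>2) \<le> K"
  shows "(\<lambda>x. (cmod (g x))\<^sup>2) summable_on UNIV"
  by (rule nonneg_bdd_above_summable_on) (auto intro!: bdd_aboveI[of _ K] assms)

text \<open>Outside square-summable functions \<open>Abs_ell2\<close> is unspecified, so an operator
  given by \<open>matrix_operator\<close> needs such a bound before its coordinates can be read
  off.\<close>

lemma coord_Abs_ell2:
  assumes "\<And>F. finite F \<Longrightarrow> (\<Sum>x\<in>F. (cmod (g x))\<^sup>2) \<le> K"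
  shows "coord (Abs_ell2 g) = g"
  using Abs_ell2_inverse square_summableI[OF assms] by blast

lemma norm_ell2_le:
  assumes "\<And>F. finite F \<Longrightarrow> (\<Sum>x\<in>F. (cmod (coord f x))\<^sup>2) \<le> K\<^sup>2" "0 \<le> K"
  shows "norm f \<le> K"
proof -
  have "(\<Sum>\<^sub>\<infinity>x. (cmod (coord f x))\<^sup>2) \<le> K\<^sup>2"
    by (rule infsum_le_finite_sums[OF coord_summable]) (use assms in auto)
  then show ?thesis
    unfolding norm_ell2_def by (rule real_le_lsqrt[rotated 1]) (rule assms)
qed

text \<open>Completeness lets the Banach fixed point theorem produce resolvents in
  \<open>fixed_point\<close>. The limit of a Cauchy sequence is built pointwise.\<close>

instance ell2 :: (type) banach
proof
  fix X :: "nat \<Rightarrow> 'a ell2"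
  assume X: "Cauchy X"
  have "convergent (\<lambda>n. coord (X n) x)" for x
  proof (rule Cauchy_convergent, rule metric_CauchyI)
    fix e :: real assume "e > 0"
    then obtain M where "\<forall>m\<ge>M. \<forall>n\<ge>M. dist (X m) (X n) < e" using X by (metis metric_CauchyD)
    then show "\<exists>M. \<forall>m\<ge>M. \<forall>n\<ge>M. dist (coord (X m) x) (coord (X n) x) < e"
      by (metis (no_types, lifting) cmod_coord_le dist_norm minus_ell2.rep_eq order_le_less_trans)
  qed
  then obtain g where g: "\<And>x. (\<lambda>n. coord (X n) x) \<longlonglongrightarrow> g x"
    unfolding convergent_def by metis
  \<comment> \<open>Finite partial sums are continuous in the coordinates, so the Cauchy estimate
    survives the pointwise limit before \<open>g\<close> is known to be square-summable.\<close>
  have tail: "(\<Sum>x\<in>F. (cmod (coord (X m) x - g x))\<^sup>2) \<le> e\<^sup>2"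
    if "\<forall>n\<ge>M. dist (X m) (X n) < e" "finite F" for m M e F
  proof (rule tendsto_upperbound)
    show "(\<lambda>n. \<Sum>x\<in>F. (cmod (coord (X m) x - coord (X n) x))\<^sup>2) \<longlonglongrightarrow>
        (\<Sum>x\<in>F. (cmod (coord (X m) x - g x))\<^sup>2)"
      by (intro tendsto_intros g)
    show "\<forall>\<^sub>F n in sequentially. (\<Sum>x\<in>F. (cmod (coord (X m) x - coord (X n) x))\<^sup>2) \<le> e\<^sup>2"
      unfolding eventually_sequentially
    proof (intro exI allI impI)
      fix n assume "M \<le> n"
      then have "norm (X m - X n) \<le> e" using that(1) by (auto simp: dist_norm less_imp_le)
      then have "(norm (X m - X n))\<^sup>2 \<le> e\<^sup>2" by (intro power_mono) auto
      with ell2_finite_sum_le[OF that(2), of "X m - X n"]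
      show "(\<Sum>x\<in>F. (cmod (coord (X m) x - coord (X n) x))\<^sup>2) \<le> e\<^sup>2"
        by (simp add: minus_ell2.rep_eq)
    qed
  qed simp
  obtain M where M: "\<forall>m\<ge>M. \<forall>n\<ge>M. dist (X m) (X n) < 1"
    using X by (metis metric_CauchyD zero_less_one)
  have "(\<lambda>x. (cmod (coord (X M) x - g x))\<^sup>2) summable_on UNIV"
    by (rule square_summableI[where K = "1\<^sup>2"]) (use tail[of M M 1] M in blast)
  then have "(\<lambda>x. (cmod (coord (X M) x + - 1 * (coord (X M) x - g x)))\<^sup>2) summable_on UNIV"
    by (intro square_summable_add square_summable_scale coord_summable)
  then have "coord (Abs_ell2 g) = g" by (intro Abs_ell2_inverse) simp
  then have "X \<longlonglongrightarrow> Abs_ell2 g"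
  proof -
    assume G: "coord (Abs_ell2 g) = g"
    show ?thesis
    proof (rule metric_LIMSEQ_I)
      fix e :: real assume "e > 0"
      then have "e / 2 > 0" by simp
      then obtain M where M: "\<forall>m\<ge>M. \<forall>n\<ge>M. dist (X m) (X n) < e / 2"
        using X by (metis metric_CauchyD)
      have "norm (X m - Abs_ell2 g) \<le> e / 2" if "m \<ge> M" for m
        by (rule norm_ell2_le) (use tail[of M m "e / 2"] M that G \<open>e > 0\<close> in \<open>auto simp: minus_ell2.rep_eq\<close>)
      then show "\<exists>M. \<forall>m\<ge>M. dist (X m) (Abs_ell2 g) < e"
        using \<open>e > 0\<close> by (intro exI[of _ M]) (force simp: dist_norm)
    qed
  qed
  then show "convergent X" unfolding convergent_def by blast
qed

section \<open>The complex inner product and evaluation at vertices\<close>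

lemma norm_scaleC: "norm (c *\<^sub>C f) = cmod c * norm f"
  unfolding norm_ell2_def scaleC.rep_eq norm_mult power_mult_distrib infsum_cmult_right'
  by (simp add: real_sqrt_mult)

lemma scaleC_of_real: "complex_of_real c *\<^sub>C f = c *\<^sub>R f"
  by (rule ell2_eqI) (simp add: scaleC.rep_eq scaleR_ell2.rep_eq)

lemmas coord_simps = plus_ell2.rep_eq minus_ell2.rep_eq uminus_ell2.rep_eq zero_ell2.rep_eq
  scaleR_ell2.rep_eq scaleC.rep_eq

lemma coord_sum: "coord (sum g I) x = (\<Sum>i\<in>I. coord (g i) x)"
  by (induction I rule: infinite_finite_induct) (auto simp: coord_simps)

lemma cinner_add_right: "cinner f (g + h) = cinner f g + cinner f h"
  unfolding cinner_def infsum_add[OF cinner_summable cinner_summable, symmetric]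
  by (simp add: coord_simps algebra_simps)

lemma cinner_scaleC_right: "cinner f (c *\<^sub>C g) = c * cinner f g"
  unfolding cinner_def infsum_cmult_right'[symmetric] by (simp add: coord_simps algebra_simps)

lemma cinner_commute: "cinner f g = cnj (cinner g f)"
  unfolding cinner_def infsum_cnj[symmetric] by (simp add: mult.commute)

lemma cinner_minus_right: "cinner f (g - h) = cinner f g - cinner f h"
  using cinner_add_right[of f "g - h" h] by simp

lemma cinner_minus_left: "cinner (g - h) f = cinner g f - cinner h f"
  by (metis cinner_commute cinner_minus_right complex_cnj_diff)

lemma cinner_scaleC_left: "cinner (c *\<^sub>C g) f = cnj c * cinner g f"
  by (metis cinner_commute cinner_scaleC_right complex_cnj_mult)

lemma cinner_delta_left: "cinner (delta a) f = coord f a"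
proof -
  have "cinner (delta a) f = (\<Sum>\<^sub>\<infinity>x\<in>{a}. coord f x)"
    unfolding cinner_def by (rule infsum_cong_neutral) (auto simp: delta.rep_eq)
  then show ?thesis by simp
qed

lemma cinner_delta_right: "cinner f (delta a) = cnj (coord f a)"
  by (metis cinner_commute cinner_delta_left)

lemma continuous_coord: "continuous_on S (\<lambda>f. coord f x)"
proof -
  have "dist (coord f x) (coord g x) \<le> dist f g" for f g :: "'a ell2"
    unfolding dist_norm by (metis cmod_coord_le minus_ell2.rep_eq)
  then show ?thesis
    unfolding continuous_on_iff by (meson order_le_less_trans)
qed

section \<open>Schur's test\<close>

lemma mult_le_sum_squares:
  fixes a b :: real
  assumes "0 \<le> a" "0 \<le> b"
  shows "a * b \<le> a\<^sup>2 + b\<^sup>2"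
  using sum_squares_bound[of a b] mult_nonneg_nonneg[OF assms] by linarith

text \<open>A symmetric, locally finite matrix of natural numbers, general enough for adjacency
  matrices with loops. \<open>schur\<close> makes \<open>w\<close> a positive supersolution at level
  \<open>L\<close>; it may lie outside the Hilbert space.\<close>

locale nat_kernel =
  fixes k :: "'v \<Rightarrow> 'v \<Rightarrow> nat" and w :: "'v \<Rightarrow> real" and L :: real
  assumes k_sym: "k x y = k y x"
    and fin: "finite {y. k x y \<noteq> 0}"
    and w_pos: "w x > 0"
    and L_nonneg: "L \<ge> 0"
    and schur: "(\<Sum>y | k x y \<noteq> 0. real (k x y) * w y) \<le> L * w x"
begin

definition A :: "'v ell2 \<Rightarrow> 'v ell2" where
  "A = matrix_operator UNIV (\<lambda>x y. of_nat (k x y))"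

lemma schur_finite:
  assumes "finite F"
  shows "(\<Sum>y\<in>F. real (k x y) * w y) \<le> L * w x"
proof -
  have "(\<Sum>y\<in>F. real (k x y) * w y) \<le> (\<Sum>y\<in>F \<union> {y. k x y \<noteq> 0}. real (k x y) * w y)"
    using assms fin by (intro sum_mono2) (auto intro!: mult_nonneg_nonneg less_imp_le[OF w_pos])
  also have "\<dots> = (\<Sum>y | k x y \<noteq> 0. real (k x y) * w y)"
    using assms fin by (intro sum.mono_neutral_right) auto
  finally show ?thesis using schur order_trans by blast
qed

lemma row_sum:
  assumes "finite F" "{y. k x y \<noteq> 0} \<subseteq> F"
  shows "(\<Sum>\<^sub>\<infinity>y. of_nat (k x y) * (f y :: complex)) = (\<Sum>y\<in>F. of_nat (k x y) * f y)"
proof -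
  have "(\<Sum>\<^sub>\<infinity>y. of_nat (k x y) * f y) = (\<Sum>\<^sub>\<infinity>y\<in>F. of_nat (k x y) * f y)"
    using assms by (intro infsum_cong_neutral) auto
  then show ?thesis using assms by simp
qed

text \<open>Cauchy-Schwarz, with each \<open>k x y * cmod (f y)\<close> split by the weight; the
  factor free of \<open>f\<close> is bounded by the Schur hypothesis.\<close>

lemma row_bound:
  fixes f :: "'v \<Rightarrow> complex"
  assumes "finite Y"
  shows "(cmod (\<Sum>y\<in>Y. of_nat (k x y) * f y))\<^sup>2 \<le>
    L * w x * (\<Sum>y\<in>Y. real (k x y) * (cmod (f y))\<^sup>2 / w y)"
proof -
  have split: "real (k x y) * cmod (f y) =
      sqrt (real (k x y) * w y) * sqrt (real (k x y) * (cmod (f y))\<^sup>2 / w y)" for y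
  proof -
    have "real (k x y) * w y * (real (k x y) * (cmod (f y))\<^sup>2 / w y) = (real (k x y) * cmod (f y))\<^sup>2"
      using w_pos[of y] by (simp add: power2_eq_square)
    then show ?thesis by (simp only: real_sqrt_mult[symmetric]) simp
  qed
  have "cmod (\<Sum>y\<in>Y. of_nat (k x y) * f y) \<le> (\<Sum>y\<in>Y. real (k x y) * cmod (f y))"
    by (rule norm_sum[THEN order_trans]) (simp add: norm_mult)
  also have "\<dots> = (\<Sum>y\<in>Y. sqrt (real (k x y) * w y) * sqrt (real (k x y) * (cmod (f y))\<^sup>2 / w y))"
    by (simp only: split)
  finally have "(cmod (\<Sum>y\<in>Y. of_nat (k x y) * f y))\<^sup>2 \<le> \<dots>\<^sup>2"
    by (intro power_mono) auto
  also have "\<dots> \<le> (\<Sum>y\<in>Y. (sqrt (real (k x y) * w y))\<^sup>2) *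
      (\<Sum>y\<in>Y. (sqrt (real (k x y) * (cmod (f y))\<^sup>2 / w y))\<^sup>2)"
    by (rule Cauchy_Schwarz_ineq_sum)
  also have "\<dots> = (\<Sum>y\<in>Y. real (k x y) * w y) * (\<Sum>y\<in>Y. real (k x y) * (cmod (f y))\<^sup>2 / w y)"
    using w_pos by (simp add: less_imp_le)
  also have "\<dots> \<le> L * w x * (\<Sum>y\<in>Y. real (k x y) * (cmod (f y))\<^sup>2 / w y)"
    by (intro mult_right_mono schur_finite assms sum_nonneg)
      (auto intro!: divide_nonneg_nonneg less_imp_le[OF w_pos])
  finally show ?thesis .
qed

text \<open>After \<open>row_bound\<close>, exchanging the sums leaves weighted column sums.
  Symmetry of \<open>k\<close> turns them into row sums, the Schur hypothesis applies a second time,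
  and the weights cancel.\<close>

lemma A_finite_bound:
  assumes F: "finite F"
  shows "(\<Sum>x\<in>F. (cmod (\<Sum>y | k x y \<noteq> 0. of_nat (k x y) * coord f y))\<^sup>2) \<le> (L * norm f)\<^sup>2"
proof -
  \<comment> \<open>Finitely many rows meet only the finite set \<open>Y\<close> of columns, so the
    exchange of sums is elementary.\<close>
  define Y where "Y = (\<Union>x\<in>F. {y. k x y \<noteq> 0})"
  have Y: "finite Y" "x \<in> F \<Longrightarrow> {y. k x y \<noteq> 0} \<subseteq> Y" for x
    using F fin by (auto simp: Y_def)
  have "(\<Sum>x\<in>F. (cmod (\<Sum>y | k x y \<noteq> 0. of_nat (k x y) * coord f y))\<^sup>2) =
      (\<Sum>x\<in>F. (cmod (\<Sum>y\<in>Y. of_nat (k x y) * coord f y))\<^sup>2)"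
    by (intro sum.cong refl arg_cong[where f = "\<lambda>t. (cmod t)\<^sup>2"] sum.mono_neutral_left)
      (use Y in auto)
  also have "\<dots> \<le> (\<Sum>x\<in>F. L * w x * (\<Sum>y\<in>Y. real (k x y) * (cmod (coord f y))\<^sup>2 / w y))"
    by (intro sum_mono row_bound Y)
  also have "\<dots> = (\<Sum>x\<in>F. \<Sum>y\<in>Y. L * (cmod (coord f y))\<^sup>2 / w y * (real (k y x) * w x))"
    unfolding sum_distrib_left by (intro sum.cong refl) (simp add: k_sym)
  also have "\<dots> = (\<Sum>y\<in>Y. L * (cmod (coord f y))\<^sup>2 / w y * (\<Sum>x\<in>F. real (k y x) * w x))"
    unfolding sum_distrib_left by (rule sum.swap)
  also have "\<dots> \<le> (\<Sum>y\<in>Y. L * (cmod (coord f y))\<^sup>2 / w y * (L * w y))"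
    by (intro sum_mono mult_left_mono schur_finite F divide_nonneg_nonneg mult_nonneg_nonneg L_nonneg)
      (auto intro: less_imp_le[OF w_pos])
  also have "\<dots> = L\<^sup>2 * (\<Sum>y\<in>Y. (cmod (coord f y))\<^sup>2)"
    unfolding sum_distrib_left using w_pos[THEN less_imp_neq]
    by (intro sum.cong refl) (auto simp: power2_eq_square)
  also have "\<dots> \<le> L\<^sup>2 * (norm f)\<^sup>2"
    by (intro mult_left_mono ell2_finite_sum_le Y) auto
  finally show ?thesis by (simp add: power_mult_distrib)
qed

lemma coord_A: "coord (A f) x = (\<Sum>y | k x y \<noteq> 0. of_nat (k x y) * coord f y)"
proof -
  have "A f = Abs_ell2 (\<lambda>x. \<Sum>y | k x y \<noteq> 0. of_nat (k x y) * coord f y)"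
    unfolding A_def matrix_operator_def row_sum[OF fin order_refl] by simp
  then show ?thesis
    by (simp only: coord_Abs_ell2[OF A_finite_bound])
qed

lemma norm_A_le: "norm (A f) \<le> L * norm f"
  by (rule norm_ell2_le) (use A_finite_bound L_nonneg in \<open>auto simp: coord_A\<close>)

lemma A_add: "A (f + g) = A f + A g"
  by (rule ell2_eqI) (simp add: coord_A coord_simps distrib_left sum.distrib)

lemma A_scaleC: "A (c *\<^sub>C f) = c *\<^sub>C A f"
  by (rule ell2_eqI) (simp add: coord_A coord_simps sum_distrib_left mult.left_commute)

lemma bounded_operator_A: "bounded_operator_on UNIV A"
  unfolding bounded_operator_on_def using norm_A_le by (auto simp: A_add A_scaleC)

lemma A_delta: "coord (A (delta y)) x = of_nat (k x y)"
proof -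
  have "coord (A (delta y)) x = (\<Sum>z | k x z \<noteq> 0. if z = y then of_nat (k x z) else 0)"
    unfolding coord_A by (intro sum.cong) (auto simp: delta.rep_eq)
  then show ?thesis using fin by (auto simp: sum.delta)
qed

lemma has_matrix_A: "has_matrix UNIV A (\<lambda>x y. of_nat (k x y))"
  unfolding has_matrix_def by (simp add: bounded_operator_A cinner_delta_left A_delta)

text \<open>Justifies the exchange of the two sums in \<open>A_selfadjoint\<close>.\<close>

lemma pair_summable:
  "(\<lambda>(x, y). of_nat (k x y) * cnj (coord f y) * coord g x) summable_on UNIV \<times> UNIV"
proof (rule abs_summable_summable, rule nonneg_bdd_above_summable_on)
  have half: "(\<Sum>x\<in>F. \<Sum>y\<in>F'. real (k x y) * (cmod (coord h y))\<^sup>2 * w x / w y) \<le> L * (norm h)\<^sup>2"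
    if "finite F" "finite F'" for F F' h
  proof -
    have "(\<Sum>x\<in>F. \<Sum>y\<in>F'. real (k x y) * (cmod (coord h y))\<^sup>2 * w x / w y) =
        (\<Sum>y\<in>F'. (cmod (coord h y))\<^sup>2 / w y * (\<Sum>x\<in>F. real (k y x) * w x))"
      unfolding sum_distrib_left
      by (subst sum.swap, intro sum.cong refl) (simp add: k_sym)
    also have "\<dots> \<le> (\<Sum>y\<in>F'. (cmod (coord h y))\<^sup>2 / w y * (L * w y))"
      by (intro sum_mono mult_left_mono schur_finite that divide_nonneg_nonneg)
        (auto intro: less_imp_le[OF w_pos])
    also have "\<dots> = L * (\<Sum>y\<in>F'. (cmod (coord h y))\<^sup>2)"
      unfolding sum_distrib_left using w_pos[THEN less_imp_neq]
      by (intro sum.cong refl) auto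
    also have "\<dots> \<le> L * (norm h)\<^sup>2"
      by (intro mult_left_mono ell2_finite_sum_le that L_nonneg)
    finally show ?thesis .
  qed
  \<comment> \<open>Weighted arithmetic-geometric inequality: with the ratio \<open>t\<close> below,
    each of the two resulting terms is summed by \<open>half\<close>, the second after swapping the
    roles of \<open>x\<close> and \<open>y\<close>.\<close>
  have le: "real (k x y) * b * c \<le> real (k x y) * b\<^sup>2 * w x / w y + real (k x y) * c\<^sup>2 * w y / w x"
    if "b \<ge> 0" "c \<ge> 0" for x y b c
  proof -
    define t where "t = sqrt (w x / w y)"
    have t: "t > 0" "t\<^sup>2 = w x / w y" using w_pos by (auto simp: t_def less_imp_le)
    have "b * c = (b * t) * (c / t)" using t by simp
    also have "\<dots> \<le> (b * t)\<^sup>2 + (c / t)\<^sup>2"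
      using that t by (intro mult_le_sum_squares) auto
    also have "\<dots> = b\<^sup>2 * w x / w y + c\<^sup>2 * w y / w x"
      by (simp add: power_mult_distrib power_divide t(2))
    finally have "real (k x y) * (b * c) \<le> real (k x y) * (b\<^sup>2 * w x / w y + c\<^sup>2 * w y / w x)"
      by (intro mult_left_mono) auto
    then show ?thesis by (simp add: algebra_simps)
  qed
  let ?t = "\<lambda>p. norm (case p of (x, y) \<Rightarrow> of_nat (k x y) * cnj (coord f y) * coord g x)"
  show "bdd_above (sum ?t ` {F. F \<subseteq> UNIV \<times> UNIV \<and> finite F})"
  proof (rule bdd_aboveI, clarify)
    fix T :: "('v \<times> 'v) set" assume T: "finite T"
    define F where "F = fst ` T"
    define F' where "F' = snd ` T"
    have F: "finite F" "finite F'" "T \<subseteq> F \<times> F'"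
      using T by (auto simp: F_def F'_def image_iff) force+
    have "sum ?t T \<le> sum ?t (F \<times> F')"
      using F by (intro sum_mono2) auto
    also have "\<dots> = (\<Sum>x\<in>F. \<Sum>y\<in>F'. real (k x y) * cmod (coord f y) * cmod (coord g x))"
      by (simp add: sum.cartesian_product norm_mult case_prod_beta)
    also have "\<dots> \<le> (\<Sum>x\<in>F. \<Sum>y\<in>F'. real (k x y) * (cmod (coord f y))\<^sup>2 * w x / w y +
        real (k x y) * (cmod (coord g x))\<^sup>2 * w y / w x)"
      by (intro sum_mono le) auto
    also have "\<dots> = (\<Sum>x\<in>F. \<Sum>y\<in>F'. real (k x y) * (cmod (coord f y))\<^sup>2 * w x / w y) +
        (\<Sum>y\<in>F'. \<Sum>x\<in>F. real (k y x) * (cmod (coord g x))\<^sup>2 * w y / w x)"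
      unfolding sum.distrib by (subst (2) sum.swap) (simp add: k_sym)
    also have "\<dots> \<le> L * (norm f)\<^sup>2 + L * (norm g)\<^sup>2"
      by (intro add_mono half F)
    finally show "sum ?t T \<le> L * (norm f)\<^sup>2 + L * (norm g)\<^sup>2" .
  qed
qed auto

lemma A_selfadjoint: "cinner (A f) g = cinner f (A g)"
proof -
  have "cinner (A f) g = (\<Sum>\<^sub>\<infinity>x. \<Sum>\<^sub>\<infinity>y. of_nat (k x y) * cnj (coord f y) * coord g x)"
    unfolding cinner_def coord_A row_sum[OF fin order_refl, symmetric] infsum_cnj[symmetric]
    by (simp add: infsum_cmult_left'[symmetric])
  also have "\<dots> = (\<Sum>\<^sub>\<infinity>y. \<Sum>\<^sub>\<infinity>x. of_nat (k x y) * cnj (coord f y) * coord g x)"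
    by (rule infsum_swap_banach[OF pair_summable])
  also have "\<dots> = cinner f (A g)"
    unfolding cinner_def coord_A row_sum[OF fin order_refl, symmetric]
    by (simp add: infsum_cmult_right'[symmetric] k_sym mult_ac)
  finally show ?thesis .
qed

lemma bounded_selfadjoint_A: "bounded_selfadjoint A"
  unfolding bounded_selfadjoint_def using bounded_operator_A A_selfadjoint by blast

end

section \<open>Resolvents and Krein's formula\<close>

lemma bounded_operator_onD:
  assumes "bounded_operator_on M T"
  shows "f \<in> M \<Longrightarrow> T f \<in> M" "f \<in> M \<Longrightarrow> g \<in> M \<Longrightarrow> T (f + g) = T f + T g"
    "f \<in> M \<Longrightarrow> T (c *\<^sub>C f) = c *\<^sub>C T f"
    "\<exists>K\<ge>0. \<forall>f\<in>M. norm (T f) \<le> K * norm f"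
proof -
  show "\<exists>K\<ge>0. \<forall>f\<in>M. norm (T f) \<le> K * norm f"
  proof -
    obtain K where K: "\<forall>f\<in>M. norm (T f) \<le> K * norm f"
      using assms unfolding bounded_operator_on_def by blast
    have "norm (T f) \<le> \<bar>K\<bar> * norm f" if "f \<in> M" for f
      using K that mult_right_mono[OF abs_ge_self, of "norm f" K] by fastforce
    then show ?thesis by (intro exI[of _ "\<bar>K\<bar>"]) auto
  qed
qed (use assms in \<open>auto simp: bounded_operator_on_def\<close>)

lemma ell2_on_iff: "f \<in> ell2_on N \<longleftrightarrow> (\<forall>x. x \<notin> N \<longrightarrow> coord f x = 0)"
  by (simp add: ell2_on_def)

lemma ell2_on_projection: "orthogonal_projection (ell2_on N) f \<in> ell2_on N"
  by (simp add: ell2_on_iff coord_orthogonal_projection_ell2_on)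

lemma projection_ell2_on: "f \<in> ell2_on N \<Longrightarrow> orthogonal_projection (ell2_on N) f = f"
  by (rule ell2_eqI) (auto simp: ell2_on_iff coord_orthogonal_projection_ell2_on)

lemma norm_projection_le: "norm (orthogonal_projection (ell2_on N) f) \<le> norm f"
proof (rule norm_ell2_le)
  fix F :: "'a set" assume "finite F"
  have "(\<Sum>x\<in>F. (cmod (coord (orthogonal_projection (ell2_on N) f) x))\<^sup>2) \<le> (\<Sum>x\<in>F. (cmod (coord f x))\<^sup>2)"
    by (intro sum_mono) (auto simp: coord_orthogonal_projection_ell2_on)
  then show "(\<Sum>x\<in>F. (cmod (coord (orthogonal_projection (ell2_on N) f) x))\<^sup>2) \<le> (norm f)\<^sup>2"
    using ell2_finite_sum_le[OF \<open>finite F\<close>] order_trans by blast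
qed simp

lemma projection_add:
  "orthogonal_projection (ell2_on N) (f + g) =
    orthogonal_projection (ell2_on N) f + orthogonal_projection (ell2_on N) g"
  by (rule ell2_eqI) (simp add: coord_orthogonal_projection_ell2_on coord_simps)

lemma projection_scaleC:
  "orthogonal_projection (ell2_on N) (c *\<^sub>C f) = c *\<^sub>C orthogonal_projection (ell2_on N) f"
  by (rule ell2_eqI) (simp add: coord_orthogonal_projection_ell2_on coord_simps)

lemma ell2_on_closed:
  "f \<in> ell2_on N \<Longrightarrow> g \<in> ell2_on N \<Longrightarrow> f + g \<in> ell2_on N"
  "f \<in> ell2_on N \<Longrightarrow> g \<in> ell2_on N \<Longrightarrow> f - g \<in> ell2_on N"
  "f \<in> ell2_on N \<Longrightarrow> c *\<^sub>C f \<in> ell2_on N"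
  by (auto simp: ell2_on_def coord_simps)

lemma scaleC_add_right: "c *\<^sub>C (f + g) = c *\<^sub>C f + c *\<^sub>C g"
  by (rule ell2_eqI) (simp add: coord_simps distrib_left)

lemma scaleC_minus_right: "c *\<^sub>C (f - g) = c *\<^sub>C f - c *\<^sub>C g"
  by (rule ell2_eqI) (simp add: coord_simps right_diff_distrib)

lemma scaleC_commute: "c *\<^sub>C d *\<^sub>C f = d *\<^sub>C c *\<^sub>C f"
  by (rule ell2_eqI) (simp add: coord_simps)

text \<open>Covers all operators that need boundedness on a subspace: \<open>D\<close> and
  \<open>E\<close> in Krein's formula, \<open>W\<close>, and, for the whole space,
  \<open>lam - A\<close>.\<close>

lemma bounded_operator_compression:
  assumes T: "bounded_operator_on UNIV T"
    and S: "\<And>f. f \<in> ell2_on N \<Longrightarrow> S f = c *\<^sub>C f + d *\<^sub>C orthogonal_projection (ell2_on N) (T f)"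
  shows "bounded_operator_on (ell2_on N) S"
proof -
  have *: "T (f + g) = T f + T g" "T (c *\<^sub>C f) = c *\<^sub>C T f" for f g c
    using bounded_operator_onD(2,3)[OF T] by auto
  obtain K where K: "K \<ge> 0" "\<And>f. norm (T f) \<le> K * norm f"
    using bounded_operator_onD(4)[OF T] by auto
  have "norm (S f) \<le> (cmod c + cmod d * K) * norm f" if f: "f \<in> ell2_on N" for f
  proof -
    have "norm (S f) \<le> cmod c * norm f + cmod d * norm (orthogonal_projection (ell2_on N) (T f))"
      unfolding S[OF f] by (rule norm_triangle_ineq[THEN order_trans]) (simp add: norm_scaleC)
    also have "\<dots> \<le> cmod c * norm f + cmod d * (K * norm f)"
      by (intro add_left_mono mult_left_mono order_trans[OF norm_projection_le K(2)]) auto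
    finally show ?thesis by (simp add: algebra_simps)
  qed
  then show ?thesis
    unfolding bounded_operator_on_def
    by (auto simp: S ell2_on_closed ell2_on_projection * projection_add projection_scaleC
        scaleC_add_right scaleC_commute[of c] scaleC_commute[of d])
qed

text \<open>Krein's formula: \<open>1 + P R' P\<close> inverts \<open>1 - P R P\<close> when \<open>R\<close> and \<open>R'\<close> are the resolvents of
  \<open>A\<close> and \<open>A + P\<close>; the hypotheses \<open>R1\<close> and \<open>R2\<close> are the two resolvent identities.\<close>

lemma
  fixes N :: "'a set"
  defines "P \<equiv> orthogonal_projection (ell2_on N)"
  assumes R: "bounded_operator_on UNIV R" and R': "bounded_operator_on UNIV R'"
    and R1: "\<And>g. R' g = R g + R (P (R' g))" and R2: "\<And>g. R' g = R g + R' (P (R g))"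
    and D: "\<And>g. g \<in> ell2_on N \<Longrightarrow> D g = g - P (R g)"
  shows krein_invertible: "invertible_on (ell2_on N) D"
    and krein_formula: "R' f = R (f + P (inv_into (ell2_on N) D (P (R f))))"
proof -
  define E where "E g = g + P (R' g)" for g
  have add: "R (f + g) = R f + R g" "R' (f + g) = R' f + R' g" "P (f + g) = P f + P g" for f g
    using bounded_operator_onD(2)[OF R] bounded_operator_onD(2)[OF R'] projection_add
    by (auto simp: P_def)
  have Pin: "P f \<in> ell2_on N" "f \<in> ell2_on N \<Longrightarrow> P f = f" for f
    by (auto simp: P_def ell2_on_projection projection_ell2_on)
  have PP: "P (P f) = P f" for f by (simp add: Pin)
  have Ein: "E g \<in> ell2_on N" if "g \<in> ell2_on N" for g
    using that by (auto simp: E_def ell2_on_closed Pin)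
  \<comment> \<open>\<open>R1\<close>, compressed by \<open>P\<close>, makes \<open>E\<close> a
    right inverse of \<open>D\<close>; \<open>R2\<close> then makes it a left inverse.\<close>
  have DE: "D (E g) = g" if "g \<in> ell2_on N" for g
  proof -
    have "P (R' g) = P (R g) + P (R (P (R' g)))" by (metis R1 add(3))
    then show ?thesis unfolding D[OF Ein[OF that]] by (simp add: E_def add)
  qed
  have ED: "E (D g) = g" if g: "g \<in> ell2_on N" for g
  proof -
    have "R' g = R' (g - P (R g)) + R' (P (R g))" by (metis add(2) diff_add_cancel)
    then have "R' (g - P (R g)) = R g" using R2[of g] by simp
    then show ?thesis unfolding D[OF g] E_def by simp
  qed
  have "bounded_operator_on (ell2_on N) D"
    by (rule bounded_operator_compression[OF R, of _ _ 1 "- 1"])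
      (auto simp: D P_def intro!: ell2_eqI simp: coord_simps)
  moreover have "bounded_operator_on (ell2_on N) E"
    by (rule bounded_operator_compression[OF R', of _ _ 1 1])
      (auto simp: E_def P_def intro!: ell2_eqI simp: coord_simps)
  ultimately show "invertible_on (ell2_on N) D"
    unfolding invertible_on_def using DE ED by blast
  have "inj_on D (ell2_on N)" by (metis ED inj_on_inverseI)
  then have "inv_into (ell2_on N) D (P (R f)) = E (P (R f))"
    by (rule inv_into_f_eq) (auto simp: Ein Pin DE)
  \<comment> \<open>\<open>R1\<close> at \<open>P (R f)\<close> collapses the last two terms to
    \<open>R' (P (R f))\<close>, and \<open>R2\<close> absorbs that.\<close>
  moreover have "R f + R (P (R f)) + R (P (R' (P (R f)))) = R' f"
    by (metis R1 R2 add add.assoc)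
  ultimately show "R' f = R (f + P (inv_into (ell2_on N) D (P (R f))))"
    by (simp add: E_def add PP add.assoc)
qed

section \<open>Resolvents beyond the Schur bound: existence, symmetry and positivity\<close>

context nat_kernel
begin

lemma A_diff: "A (f - g) = A f - A g"
  using A_add[of "f - g" g] by simp

lemma bounded_linear_A: "bounded_linear A"
  by (rule bounded_linear_intro[where K = L])
    (auto simp: A_add A_scaleC scaleC_of_real[symmetric] norm_A_le mult.commute)

text \<open>The equation reads \<open>f = (g + A f) / lam\<close>, a contraction with constant
  \<open>L / lam\<close>. The invariant set \<open>S\<close> locates the solution:
  \<open>UNIV\<close> gives solvability, an order interval gives positivity and domination.\<close>

lemma fixed_point:
  fixes lam :: real
  assumes lam: "L < lam" and S: "closed S" "S \<noteq> {}"
    and inv: "\<And>f. f \<in> S \<Longrightarrow> (1 / lam) *\<^sub>R (g + A f) \<in> S"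
  shows "\<exists>f\<in>S. complex_of_real lam *\<^sub>C f - A f = g"
proof -
  have pos: "lam > 0" using lam L_nonneg by linarith
  have "\<exists>!f\<in>S. (1 / lam) *\<^sub>R (g + A f) = f"
  proof (rule Banach_fix[where c = "L / lam"])
    show "complete S" using S by (simp add: complete_eq_closed)
    show "dist ((1 / lam) *\<^sub>R (g + A f)) ((1 / lam) *\<^sub>R (g + A h)) \<le> L / lam * dist f h" for f h
    proof -
      have "dist ((1 / lam) *\<^sub>R (g + A f)) ((1 / lam) *\<^sub>R (g + A h)) = norm (A (f - h)) / lam"
        unfolding dist_norm scaleR_diff_right[symmetric] norm_scaleR using pos by (simp add: A_diff)
      also have "\<dots> \<le> L * norm (f - h) / lam" using pos by (intro divide_right_mono norm_A_le) auto
      finally show ?thesis by (simp add: dist_norm)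
    qed
  qed (use S inv pos L_nonneg lam in auto)
  then obtain f where f: "f \<in> S" "(1 / lam) *\<^sub>R (g + A f) = f" by blast
  have "lam *\<^sub>R f = lam *\<^sub>R (1 / lam) *\<^sub>R (g + A f)" by (simp only: f(2))
  also have "\<dots> = g + A f" using pos by simp
  finally have "complex_of_real lam *\<^sub>C f - A f = g" by (simp add: scaleC_of_real)
  with f(1) show ?thesis by blast
qed

context
  fixes lam :: real
  assumes lam: "L < lam"
begin

text \<open>Source of both injectivity of \<open>lam - A\<close> and the bound
  \<open>1 / (lam - L)\<close> on the resolvent.\<close>

lemma norm_le_shifted: "(lam - L) * norm f \<le> norm (complex_of_real lam *\<^sub>C f - A f)"
proof -
  have "lam * norm f = norm (complex_of_real lam *\<^sub>C f)" using lam L_nonneg by (simp add: norm_scaleC)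
  also have "\<dots> \<le> norm (complex_of_real lam *\<^sub>C f - A f) + L * norm f"
    using norm_triangle_sub norm_A_le by (metis add_left_mono order_trans add.commute)
  finally show ?thesis by (simp add: algebra_simps)
qed

lemma inj_shifted: "complex_of_real lam *\<^sub>C f - A f = complex_of_real lam *\<^sub>C g - A g \<Longrightarrow> f = g"
proof -
  assume "complex_of_real lam *\<^sub>C f - A f = complex_of_real lam *\<^sub>C g - A g"
  then have "complex_of_real lam *\<^sub>C (f - g) - A (f - g) = 0"
    by (simp add: A_diff scaleC_minus_right algebra_simps)
  then show "f = g" using norm_le_shifted[of "f - g"] lam by (simp add: mult_le_0_iff)
qed

text \<open>\<open>resolvent\<close> is a choice of preimage; injectivity makes any solution of the
  equation the chosen one.\<close>

lemma resolvent_eqI: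
  "complex_of_real lam *\<^sub>C f - A f = g \<Longrightarrow> resolvent A (complex_of_real lam) g = f"
  unfolding resolvent_def by (rule inv_f_eq) (auto intro: injI inj_shifted)

lemma resolvent_right:
  "complex_of_real lam *\<^sub>C resolvent A (complex_of_real lam) g - A (resolvent A (complex_of_real lam) g) = g"
  using fixed_point[OF lam, of UNIV g] resolvent_eqI by auto

lemma bounded_operator_resolvent: "bounded_operator_on UNIV (resolvent A (complex_of_real lam))"
proof -
  let ?R = "resolvent A (complex_of_real lam)"
  have "?R (f + g) = ?R f + ?R g" for f g
  proof (rule resolvent_eqI)
    have "complex_of_real lam *\<^sub>C (?R f + ?R g) - A (?R f + ?R g) =
        (complex_of_real lam *\<^sub>C ?R f - A (?R f)) + (complex_of_real lam *\<^sub>C ?R g - A (?R g))"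
      by (simp add: A_add scaleC_add_right)
    then show "complex_of_real lam *\<^sub>C (?R f + ?R g) - A (?R f + ?R g) = f + g"
      by (simp only: resolvent_right)
  qed
  moreover have "?R (c *\<^sub>C f) = c *\<^sub>C ?R f" for c f
  proof (rule resolvent_eqI)
    have "complex_of_real lam *\<^sub>C (c *\<^sub>C ?R f) - A (c *\<^sub>C ?R f) =
        c *\<^sub>C (complex_of_real lam *\<^sub>C ?R f - A (?R f))"
      by (simp add: A_scaleC scaleC_minus_right scaleC_commute)
    then show "complex_of_real lam *\<^sub>C (c *\<^sub>C ?R f) - A (c *\<^sub>C ?R f) = c *\<^sub>C f"
      by (simp only: resolvent_right)
  qed
  moreover have "norm (?R f) \<le> 1 / (lam - L) * norm f" for f
    using norm_le_shifted[of "?R f"] lam unfolding resolvent_right by (simp add: field_simps)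
  ultimately show ?thesis unfolding bounded_operator_on_def by blast
qed

lemma in_resolvent_set_A: "in_resolvent_set A (complex_of_real lam)"
proof -
have "bounded_operator_on (ell2_on UNIV) (\<lambda>f. complex_of_real lam *\<^sub>C f - A f)"
  proof (rule bounded_operator_compression[OF bounded_operator_A, of _ _ "complex_of_real lam" "- 1"])
    fix f :: "'v ell2"
    have "orthogonal_projection (ell2_on UNIV) (A f) = A f" by (rule projection_ell2_on) simp
    then show "complex_of_real lam *\<^sub>C f - A f =
        complex_of_real lam *\<^sub>C f + - 1 *\<^sub>C orthogonal_projection (ell2_on UNIV) (A f)"
      by (intro ell2_eqI) (simp add: coord_simps)
  qed
  then show ?thesis
    unfolding ell2_on_UNIV in_resolvent_set_def invertible_on_def
    using bounded_operator_resolvent resolvent_right resolvent_eqI by blast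
qed

lemma resolvent_selfadjoint:
  "cinner (resolvent A (complex_of_real lam) f) g = cinner f (resolvent A (complex_of_real lam) g)"
proof -
  let ?R = "resolvent A (complex_of_real lam)"
  have "cinner (?R f) g = cinner (?R f) (complex_of_real lam *\<^sub>C ?R g - A (?R g))"
    by (simp only: resolvent_right)
  also have "\<dots> = cinner (complex_of_real lam *\<^sub>C ?R f - A (?R f)) (?R g)"
    by (simp add: cinner_minus_left cinner_minus_right cinner_scaleC_left cinner_scaleC_right A_selfadjoint)
  finally show ?thesis by (simp only: resolvent_right)
qed

text \<open>The resolvent is positivity preserving, so a nonnegative solution of \<open>(L - A) U \<ge> \<delta>\<^sub>a\<close>,
  square-summable or not, dominates \<open>R \<delta>\<^sub>a\<close> uniformly in the spectral parameter.\<close>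

lemma resolvent_delta_le:
  fixes U :: "'v \<Rightarrow> real"
  assumes U: "\<And>x. U x \<ge> 0"
    and super: "\<And>x. (\<Sum>y | k x y \<noteq> 0. real (k x y) * U y) + (if x = a then 1 else 0) \<le> L * U x"
  shows "Re (coord (resolvent A (complex_of_real lam) (delta a)) x) \<le> U x"
proof -
  \<comment> \<open>The order interval of real functions between \<open>0\<close> and
    \<open>U\<close>. The iteration preserves it because the kernel is nonnegative and
    \<open>super\<close> at level \<open>L\<close> implies the same inequality at level
    \<open>lam\<close>.\<close>
  define S where "S = {f. \<forall>y. coord f y \<in> {z. Im z = 0 \<and> 0 \<le> Re z \<and> Re z \<le> U y}}"
  have pos: "lam > 0" using lam L_nonneg by linarith
  have "\<exists>f\<in>S. complex_of_real lam *\<^sub>C f - A f = delta a"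
  proof (rule fixed_point[OF lam])
    show "closed S"
      unfolding S_def
    proof (rule closed_Collect_all)
      fix y
      have "closed {z. Im z = 0 \<and> 0 \<le> Re z \<and> Re z \<le> U y}"
        by (intro closed_Collect_conj closed_Collect_eq closed_Collect_le continuous_intros)
      then have "closed ((\<lambda>f. coord f y) -` {z. Im z = 0 \<and> 0 \<le> Re z \<and> Re z \<le> U y})"
        by (intro closed_vimage continuous_coord)
      then show "closed {f. coord f y \<in> {z. Im z = 0 \<and> 0 \<le> Re z \<and> Re z \<le> U y}}"
        by (simp add: vimage_def)
    qed
    \<comment> \<open>The zero function is the witness, since \<open>U\<close> may lie outside the
      Hilbert space.\<close>
    have "0 \<in> S" by (auto simp: S_def coord_simps U)
    then show "S \<noteq> {}" by blast
    fix f assume f: "f \<in> S"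
    show "(1 / lam) *\<^sub>R (delta a + A f) \<in> S"
      unfolding S_def
    proof (rule CollectI, rule allI)
      fix y
      define c where "c = coord ((1 / lam) *\<^sub>R (delta a + A f)) y"
      have re: "Re c = ((if y = a then 1 else 0) + (\<Sum>z | k y z \<noteq> 0. real (k y z) * Re (coord f z))) / lam"
        by (simp add: c_def coord_simps delta.rep_eq coord_A Re_divide_of_real)
      have im: "Im c = (\<Sum>z | k y z \<noteq> 0. real (k y z) * Im (coord f z)) / lam"
        by (simp add: c_def coord_simps delta.rep_eq coord_A Im_divide_of_real)
      have "(\<Sum>z | k y z \<noteq> 0. real (k y z) * Re (coord f z)) \<le> (\<Sum>z | k y z \<noteq> 0. real (k y z) * U z)"
        using f by (intro sum_mono mult_left_mono) (auto simp: S_def)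
      then have "(if y = a then 1 else 0) + (\<Sum>z | k y z \<noteq> 0. real (k y z) * Re (coord f z)) \<le> lam * U y"
        using super[of y] mult_right_mono[OF less_imp_le[OF lam] U[of y]] by linarith
      then have "Re c \<le> U y" unfolding re using pos by (simp add: pos_divide_le_eq mult.commute)
      moreover have "0 \<le> Re c" unfolding re using f pos by (auto simp: S_def intro!: divide_nonneg_pos add_nonneg_nonneg sum_nonneg)
      moreover have "Im c = 0" unfolding im using f by (auto simp: S_def)
      ultimately show "c \<in> {z. Im z = 0 \<and> 0 \<le> Re z \<and> Re z \<le> U y}" by blast
    qed
  qed
  then obtain f where f: "f \<in> S" "complex_of_real lam *\<^sub>C f - A f = delta a" by blast
  show ?thesis unfolding resolvent_eqI[OF f(2)] using f(1) by (auto simp: S_def)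
qed

end

end

section \<open>Homogeneous trees\<close>

lemma adjacent_commute: "adjacent X x y \<longleftrightarrow> adjacent X y x"
  by (simp add: adjacent_def insert_commute)

lemma walk_singleton: "walk_betw X x [x] x"
  by (simp add: walk_betw_def)

lemma walk_Cons: "adjacent X x y \<Longrightarrow> walk_betw X y w z \<Longrightarrow> walk_betw X x (x # w) z"
  by (cases w) (auto simp: walk_betw_def)

lemma walk_rev: "walk_betw X x w y \<Longrightarrow> walk_betw X y (rev w) x"
  by (auto simp: walk_betw_def hd_rev last_rev adjacent_commute)

lemma walk_append:
  assumes "walk_betw X x u y" "walk_betw X y v z"
  shows "walk_betw X x (u @ tl v) z"
  using assms
  by (cases v; cases "tl v")
    (auto simp: walk_betw_def successively_append_iff)

text \<open>Loop erasure: cutting out the piece between two visits to a vertex shortens the walk and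
  keeps its ends.\<close>

lemma distinct_walk:
  assumes "walk_betw X x w y"
  shows "\<exists>w'. walk_betw X x w' y \<and> distinct w' \<and> set w' \<subseteq> set w"
  using assms
proof (induction "length w" arbitrary: w rule: less_induct)
  case less
  show ?case
  proof (cases "distinct w")
    case False
    then obtain as a bs cs where w: "w = as @ [a] @ bs @ [a] @ cs" by (metis not_distinct_decomp)
    have "successively (adjacent X) (as @ ([a] @ bs @ [a] @ cs))"
      using less.prems by (simp add: w walk_betw_def)
    then have 1: "successively (adjacent X) as" "as \<noteq> [] \<longrightarrow> adjacent X (last as) a"
      and "successively (adjacent X) (([a] @ bs) @ ([a] @ cs))"
      unfolding successively_append_iff[of _ as] by auto
    then have "successively (adjacent X) ([a] @ cs)"
      unfolding successively_append_iff[of _ "[a] @ bs"] by blast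
    with 1 have "successively (adjacent X) (as @ [a] @ cs)"
      unfolding successively_append_iff[of _ as] by auto
    then have "walk_betw X x (as @ [a] @ cs) y"
      using less.prems unfolding w walk_betw_def by (auto simp: hd_append split: if_splits)
    then show ?thesis
      using less.hyps[of "as @ [a] @ cs"] w by fastforce
  qed (use less.prems in blast)
qed

section \<open>Absence of cycles and the size of neighbourhoods\<close>

locale tree =
  fixes Q :: nat and G :: "('v, 'e) graph"
  assumes Q_ge: "2 \<le> Q" and tree: "homogeneous_tree Q G"
begin

abbreviation d where "d \<equiv> graph_dist G"

definition nb :: "'v \<Rightarrow> 'v set" where "nb x = {y. adjacent G x y}"

lemma nb_iff: "y \<in> nb x \<longleftrightarrow> adjacent G x y" by (simp add: nb_def)
lemma nb_sym: "y \<in> nb x \<longleftrightarrow> x \<in> nb y" by (simp add: nb_iff adjacent_commute)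

lemma connected: "\<exists>w. walk_betw G x w y"
  using tree by (simp add: homogeneous_tree_def graph_connected_def)

lemma acyclic: "\<not> is_cycle G vs es"
  using tree by (simp add: homogeneous_tree_def)

lemma no_loop: "x \<notin> nb x"
proof
  assume "x \<in> nb x"
  then obtain e where "e \<in> edges G" "ends G e = {x}" by (auto simp: nb_iff adjacent_def)
  then have "is_cycle G [x] [e]" by (simp add: is_cycle_def)
  then show False using acyclic by blast
qed

lemma no_parallel:
  assumes "e \<in> edges G" "e' \<in> edges G" "ends G e = {x, y}" "ends G e' = {x, y}"
  shows "e = e'"
proof (rule ccontr)
  assume "e \<noteq> e'"
  moreover have "x \<noteq> y" using assms no_loop[of x] by (auto simp: nb_iff adjacent_def)
  ultimately have "is_cycle G [x, y] [e, e']"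
    using assms by (auto simp: is_cycle_def less_Suc_eq insert_commute)
  then show False using acyclic by blast
qed

text \<open>Choosing an edge for each consecutive pair, cyclically, turns the closed walk into a
  cycle of the graph.\<close>

lemma no_long_cycle:
  assumes "distinct vs" "length vs \<ge> 3" "successively (adjacent G) vs" "adjacent G (last vs) (hd vs)"
  shows False
proof -
  define n where "n = length vs"
  have n: "n \<ge> 3" "vs \<noteq> []" using assms by (auto simp: n_def)
  have adj: "adjacent G (vs ! i) (vs ! (Suc i mod n))" if "i < n" for i
  proof (cases "Suc i < n")
    case True
    then show ?thesis using assms(3) by (simp add: n_def successively_conv_nth)
  next
    case False
    then have "Suc i = n" using that by simp
    then have "last vs = vs ! i" "hd vs = vs ! 0" using n by (auto simp: n_def last_conv_nth hd_conv_nth dest!: sym[of "Suc i"])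
    then show ?thesis using assms(4) \<open>Suc i = n\<close> by simp
  qed
  define e where "e i = (SOME e. e \<in> edges G \<and> ends G e = {vs ! i, vs ! (Suc i mod n)})" for i
  have e: "e i \<in> edges G \<and> ends G (e i) = {vs ! i, vs ! (Suc i mod n)}" if "i < n" for i
    unfolding e_def by (rule someI_ex) (use adj[OF that] in \<open>auto simp: adjacent_def\<close>)
  have "inj_on e {..<n}"
  proof (rule inj_onI)
    fix i j assume ij: "i \<in> {..<n}" "j \<in> {..<n}" "e i = e j"
    have eq: "{vs ! i, vs ! (Suc i mod n)} = {vs ! j, vs ! (Suc j mod n)}"
      using e[of i] e[of j] ij by simp
    have nth: "vs ! a = vs ! b \<longleftrightarrow> a = b" if "a < n" "b < n" for a b
      using that assms(1) by (simp add: n_def nth_eq_iff_index_eq)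
    have lt: "i < n" "j < n" "Suc i mod n < n" "Suc j mod n < n" using ij n by auto
    have "vs ! i = vs ! j \<or> vs ! i = vs ! (Suc j mod n) \<and> vs ! (Suc i mod n) = vs ! j"
      using eq unfolding doubleton_eq_iff by blast
    then have "i = j \<or> i = Suc j mod n \<and> Suc i mod n = j"
      unfolding nth[OF lt(1,2)] nth[OF lt(1,4)] nth[OF lt(3,2)] by blast
    \<comment> \<open>Equal ends traversed in opposite directions would make \<open>i\<close> and
      \<open>j\<close> cyclic successors of each other, impossible for
      \<open>n \<ge> 3\<close>.\<close>
    moreover have False if *: "i = Suc j mod n" "Suc i mod n = j"
    proof -
      have m: "Suc m mod n = (if Suc m = n then 0 else Suc m)" if "m < n" for m
        using that by (simp add: mod_Suc)
      show False
        using *[unfolded m[OF lt(1)] m[OF lt(2)]] n(1) by (simp split: if_splits)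
    qed
    ultimately show "i = j" by blast
  qed
  then have "distinct (map e [0..<n])" by (auto simp: distinct_map atLeast0LessThan)
  then have "is_cycle G vs (map e [0..<n])"
    unfolding is_cycle_def using e assms(1) n by (auto simp: n_def)
  then show False using acyclic by blast
qed

lemma edge_count_eq: "edge_count G x y = (if y \<in> nb x then 1 else 0)"
proof (cases "y \<in> nb x")
  case True
  then obtain e where e: "e \<in> edges G" "ends G e = {x, y}" by (auto simp: nb_iff adjacent_def)
  then have "{e \<in> edges G. ends G e = {x, y}} = {e}" using no_parallel by blast
  then show ?thesis using True by (simp add: edge_count_def)
next
  case False
  then have "{e \<in> edges G. ends G e = {x, y}} = {}" by (auto simp: nb_iff adjacent_def)
  then show ?thesis using False by (simp only: edge_count_def card.empty if_False)
qed

text \<open>The degree counts incident edges; without parallel edges, sending an edge to its other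
  end is a bijection onto the neighbours.\<close>

lemma card_nb: "card (nb x) = Q" and finite_nb: "finite (nb x)"
proof -
  define I where "I = {e \<in> edges G. x \<in> ends G e}"
  have "\<exists>y. y \<in> nb x \<and> ends G e = {x, y}" if e: "e \<in> I" for e
  proof -
    have "card (ends G e) = 1 \<or> card (ends G e) = 2"
      using tree e by (auto simp: homogeneous_tree_def valid_graph_def I_def)
    then obtain y where "ends G e = {x, y}"
    proof
      assume "card (ends G e) = 1"
      then obtain z where "ends G e = {z}" by (meson card_1_singletonE)
      then have "ends G e = {x, x}" using e by (simp add: I_def)
      then show ?thesis by (rule that)
    next
      assume "card (ends G e) = 2"
      then obtain u v where "ends G e = {u, v}" by (meson card_2_iff)
      then have "ends G e = {x, u} \<or> ends G e = {x, v}" using e by (auto simp: I_def)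
      then show ?thesis using that by blast
    qed
    then show ?thesis using e by (auto simp: I_def nb_iff adjacent_def)
  qed
  then obtain t where t: "\<And>e. e \<in> I \<Longrightarrow> t e \<in> nb x \<and> ends G e = {x, t e}" by metis
  have "inj_on t I"
    by (rule inj_onI) (metis (no_types, lifting) I_def mem_Collect_eq no_parallel t)
  moreover have "t ` I = nb x"
  proof (intro equalityI subsetI)
    fix y assume y: "y \<in> nb x"
    then obtain e where e: "e \<in> edges G" "ends G e = {x, y}" by (auto simp: nb_iff adjacent_def)
    then have "e \<in> I" by (auto simp: I_def)
    then have "{x, t e} = {x, y}" using t e by simp
    then have "y = t e" by (metis doubleton_eq_iff)
    then show "y \<in> t ` I" using \<open>e \<in> I\<close> by blast
  qed (use t in auto)
  ultimately have "card (nb x) = card I" by (metis card_image)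
  then show "card (nb x) = Q"
    using tree by (simp add: I_def homogeneous_tree_def vertex_degree_def)
  \<comment> \<open>Infinite sets have cardinality \<open>0\<close>, so a cardinality of at least
    \<open>2\<close> certifies finiteness.\<close>
  then show "finite (nb x)" using Q_ge card.infinite by fastforce
qed

section \<open>Distances in the tree\<close>

lemma geodesic: "\<exists>w. walk_betw G x w y \<and> length w = Suc (d x y)"
proof -
  obtain w where "walk_betw G x w y" using connected by blast
  then have "\<exists>n w. walk_betw G x w y \<and> length w = Suc n"
    by (intro exI[of _ "length w - 1"] exI[of _ w]) (auto simp: walk_betw_def)
  then show ?thesis unfolding graph_dist_def by (rule LeastI_ex)
qed

lemma d_le: "walk_betw G x w y \<Longrightarrow> length w = Suc n \<Longrightarrow> d x y \<le> n"
  unfolding graph_dist_def by (rule Least_le) blast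

lemma d_commute: "d x y = d y x"
proof -
  have "d y x \<le> d x y" for x y using geodesic[of x y] walk_rev d_le by (metis length_rev)
  then show ?thesis by (simp add: antisym)
qed

lemma d_self [simp]: "d x x = 0"
  using d_le[OF walk_singleton] by force

lemma d_eq_0: "d x y = 0 \<Longrightarrow> x = y"
  using geodesic[of x y] by (auto simp: walk_betw_def length_Suc_conv)

lemma d_nb_le: "z \<in> nb x \<Longrightarrow> d x y \<le> Suc (d z y)"
  using geodesic[of z y] by (metis d_le length_Cons nb_iff walk_Cons)

lemma d_triangle: "d x z \<le> d x y + d y z"
proof -
  obtain u v where "walk_betw G x u y" "length u = Suc (d x y)" "walk_betw G y v z" "length v = Suc (d y z)"
    using geodesic by metis
  then show ?thesis using walk_append by (intro d_le[of _ "u @ tl v"]) auto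
qed

lemma closer_ex:
  assumes "x \<noteq> y"
  shows "\<exists>z\<in>nb x. d x y = Suc (d z y)"
proof -
  obtain w where w: "walk_betw G x w y" "length w = Suc (d x y)" using geodesic by blast
  obtain w' where w': "w = x # w'" using w by (cases w) (auto simp: walk_betw_def)
  have "w' \<noteq> []" using w w' assms by (auto simp: walk_betw_def)
  then have z: "hd w' \<in> nb x" "walk_betw G (hd w') w' y"
    using w w' by (auto simp: walk_betw_def nb_iff successively_Cons)
  have "d x y \<noteq> 0" using assms d_eq_0 by blast
  then have "d (hd w') y \<le> d x y - 1" using w w' by (intro d_le[OF z(2)]) auto
  moreover have "d x y \<le> Suc (d (hd w') y)" using d_nb_le z by blast
  ultimately show ?thesis using z \<open>d x y \<noteq> 0\<close> by (intro bexI[of _ "hd w'"]) auto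
qed

text \<open>A geodesic from \<open>z\<close> through \<open>x\<close> would make
  \<open>d z y\<close> larger than \<open>d x y\<close>.\<close>

lemma geodesic_avoids:
  assumes "z \<in> nb x" "d z y \<le> d x y"
  shows "\<exists>w. walk_betw G z w y \<and> x \<notin> set w"
proof -
  obtain w where w: "walk_betw G z w y" "length w = Suc (d z y)" using geodesic by blast
  have "x \<notin> set w"
  proof
    assume "x \<in> set w"
    then obtain as bs where ab: "w = as @ x # bs" by (meson split_list)
    then have "as \<noteq> []" using w assms(1) no_loop by (auto simp: walk_betw_def)
    have "walk_betw G x (x # bs) y" using w(1) unfolding ab walk_betw_def
      by (auto simp: successively_append_iff)
    then have "d x y \<le> length bs" by (intro d_le) auto
    then show False using w(2) ab assms(2) \<open>as \<noteq> []\<close> by (cases as) auto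
  qed
  then show ?thesis using w by blast
qed

text \<open>Two such neighbours could be joined by way of \<open>y\<close> without meeting
  \<open>x\<close>, and closing that walk through \<open>x\<close> would give a cycle. The
  non-strict inequality also rules out neighbours at equal distance.\<close>

lemma closer_unique:
  assumes "z \<in> nb x" "d z y \<le> d x y" "z' \<in> nb x" "d z' y \<le> d x y"
  shows "z = z'"
proof (rule ccontr)
  assume "z \<noteq> z'"
  obtain u v where uv: "walk_betw G z u y" "x \<notin> set u" "walk_betw G z' v y" "x \<notin> set v"
    using geodesic_avoids assms by metis
  have "walk_betw G z (u @ tl (rev v)) z'" using uv walk_append walk_rev by metis
  moreover have "x \<notin> set (u @ tl (rev v))" using uv by (metis Un_iff list.set_sel(2) set_append set_rev tl_Nil)
  ultimately obtain w where w: "walk_betw G z w z'" "distinct w" "x \<notin> set w"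
    using distinct_walk by (metis subset_code(1))
  have "length w \<noteq> 1" "w \<noteq> []" using w \<open>z \<noteq> z'\<close> by (auto simp: walk_betw_def length_Suc_conv)
  then have "length (x # w) \<ge> 3" by (cases w; cases "tl w") auto
  moreover have "successively (adjacent G) (x # w)" "adjacent G (last (x # w)) (hd (x # w))"
    using w assms by (auto simp: walk_betw_def nb_iff successively_Cons adjacent_commute)
  ultimately show False using no_long_cycle[of "x # w"] w by auto
qed

text \<open>The branching structure seen from \<open>y\<close>; it reduces neighbour sums of radial
  functions to a two-term expression.\<close>

lemma nb_split:
  assumes "x \<noteq> y"
  shows "\<exists>z\<in>nb x. d x y = Suc (d z y) \<and> (\<forall>z'\<in>nb x - {z}. d z' y = Suc (d x y))"
proof -
  obtain z where z: "z \<in> nb x" "d x y = Suc (d z y)" using closer_ex[OF assms] by blast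
  have "d z' y = Suc (d x y)" if "z' \<in> nb x - {z}" for z'
  proof -
    have "\<not> d z' y \<le> d x y" using closer_unique[of z x y z'] z that by auto
    moreover have "d z' y \<le> Suc (d x y)" using d_nb_le[of x z' y] nb_sym that by blast
    ultimately show ?thesis by simp
  qed
  with z show ?thesis by blast
qed

lemma nb_dist: "z \<in> nb x \<Longrightarrow> d z x = 1"
  using d_nb_le[of x z x] d_eq_0[of z x] no_loop nb_sym by fastforce

text \<open>The adjacency operator on a radial exponential. The natural subtraction occurs only for
  \<open>x \<noteq> y\<close>, where the distance is positive.\<close>

lemma nb_sum:
  fixes a :: real
  shows "(\<Sum>z\<in>nb x. a ^ d z y) =
    (if x = y then real Q * a else a ^ (d x y - 1) + (real Q - 1) * a ^ Suc (d x y))"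
proof (cases "x = y")
  case True
  then have "(\<Sum>z\<in>nb x. a ^ d z y) = (\<Sum>z\<in>nb x. a)" using nb_dist by (intro sum.cong) auto
  then show ?thesis using True by (simp add: card_nb)
next
  case False
  obtain z where z: "z \<in> nb x" "d x y = Suc (d z y)" "\<forall>z'\<in>nb x - {z}. d z' y = Suc (d x y)"
    using nb_split[OF False] by blast
  have "(\<Sum>z'\<in>nb x. a ^ d z' y) = a ^ d z y + (\<Sum>z'\<in>nb x - {z}. a ^ d z' y)"
    by (rule sum.remove[OF finite_nb z(1)])
  also have "(\<Sum>z'\<in>nb x - {z}. a ^ d z' y) = (\<Sum>z'\<in>nb x - {z}. a ^ Suc (d x y))"
    using z(3) by (intro sum.cong refl) simp
  also have "\<dots> = (real Q - 1) * a ^ Suc (d x y)"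
    using z(1) Q_ge by (simp add: card_nb finite_nb of_nat_diff)
  finally show ?thesis using False z(2) by simp
qed

text \<open>A path without repetition cannot turn back: the previous vertex is already the unique
  neighbour not farther from the start, so the next one is farther.\<close>

lemma path_dist:
  assumes "infinite_path_from G r p"
  shows "d (p n) (p (n + k)) = k"
proof -
  have p: "inj p" "\<And>n. p (Suc n) \<in> nb (p n)"
    using assms by (auto simp: infinite_path_from_def nb_iff)
  \<comment> \<open>Two consecutive distances are carried along, since the step compares the next
    vertex with the previous one.\<close>
  have "d (p (n + k)) (p n) = k \<and> d (p (n + Suc k)) (p n) = Suc k" for k
  proof (induction k)
    case 0
    then show ?case using nb_dist p by simp
  next
    case (Suc k)
    let ?x = "p (n + Suc k)"
    have ne: "p (n + k) \<noteq> p (n + Suc (Suc k))" using p(1) by (auto dest: injD)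
    have "p (n + k) \<in> nb ?x" "p (n + Suc (Suc k)) \<in> nb ?x" using p(2) nb_sym by auto
    then have "\<not> d (p (n + Suc (Suc k))) (p n) \<le> d ?x (p n)"
      using closer_unique[of "p (n + k)" ?x "p n" "p (n + Suc (Suc k))"] ne Suc by auto
    moreover have "d (p (n + Suc (Suc k))) (p n) \<le> Suc (d ?x (p n))"
      using d_nb_le[of ?x "p (n + Suc (Suc k))" "p n"] p(2) nb_sym by auto
    ultimately show ?case using Suc by simp
  qed
  then show ?thesis by (simp add: d_commute)
qed

text \<open>Away from the centre one neighbour of each vertex points inward, leaving at most
  \<open>Q - 1\<close> outward ones.\<close>

lemma card_sphere: "finite {x. d x y = n}" "card {x. d x y = Suc n} \<le> Q * (Q - 1) ^ n"
proof -
  have sub: "{x. d x y = Suc m} \<subseteq> (\<Union>z\<in>{z. d z y = m}. {x\<in>nb z. d x y = Suc m})" for m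
  proof
    fix x assume "x \<in> {x. d x y = Suc m}"
    then have x: "d x y = Suc m" by simp
    then have "x \<noteq> y" by auto
    then show "x \<in> (\<Union>z\<in>{z. d z y = m}. {x\<in>nb z. d x y = Suc m})"
      using closer_ex[of x y] x nb_sym by auto
  qed
  have fin: "finite {x. d x y = m}" for m
  proof (induction m)
    case 0
    have "{x. d x y = 0} \<subseteq> {y}" using d_eq_0 by blast
    then show ?case using finite_subset by blast
  next
    case (Suc m)
    then show ?case using finite_subset[OF sub[of m]] finite_nb by auto
  qed
  then show "finite {x. d x y = n}" .
  show "card {x. d x y = Suc n} \<le> Q * (Q - 1) ^ n"
  proof (induction n)
    case 0
    have "{x. d x y = Suc 0} \<subseteq> nb y" using sub[of 0] d_eq_0 by auto
    then show ?case using card_mono[OF finite_nb, of _ y] by (simp add: card_nb)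
  next
    case (Suc n)
    have "card {x\<in>nb z. d x y = Suc (Suc n)} \<le> Q - 1" if z: "d z y = Suc n" for z
    proof -
      have "z \<noteq> y" using z by auto
      then obtain u where u: "u \<in> nb z" "d z y = Suc (d u y)" using closer_ex by blast
      then have "{x\<in>nb z. d x y = Suc (Suc n)} \<subseteq> nb z - {u}" using z by auto
      then have "card {x\<in>nb z. d x y = Suc (Suc n)} \<le> card (nb z - {u})"
        by (intro card_mono) (auto simp: finite_nb)
      then show ?thesis using u by (simp add: card_nb finite_nb)
    qed
    then have "(\<Sum>z | d z y = Suc n. card {x\<in>nb z. d x y = Suc (Suc n)}) \<le> (\<Sum>z | d z y = Suc n. Q - 1)"
      by (intro sum_mono) auto
    moreover have "card {x. d x y = Suc (Suc n)} \<le> (\<Sum>z | d z y = Suc n. card {x\<in>nb z. d x y = Suc (Suc n)})"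
      using card_mono[OF _ sub[of "Suc n"]] card_UN_le[OF fin, of "\<lambda>z. {x\<in>nb z. d x y = Suc (Suc n)}" "Suc n"]
        fin finite_nb by (auto intro: order_trans)
    ultimately have "card {x. d x y = Suc (Suc n)} \<le> card {x. d x y = Suc n} * (Q - 1)" by simp
    also have "\<dots> \<le> Q * (Q - 1) ^ n * (Q - 1)" using Suc by (rule mult_right_mono) simp
    finally show ?case by (simp add: mult_ac)
  qed
qed

text \<open>Summation over spheres, whose growth against \<open>b ^ n\<close> gives a geometric
  series. It is used with \<open>b = a\<^sup>2\<close> for square-summability.\<close>

lemma power_dist_sum_le:
  fixes b :: real
  assumes b: "0 \<le> b" "real (Q - 1) * b < 1" and F: "finite F"
  shows "(\<Sum>x\<in>F. b ^ d x y) \<le> 1 + real Q * b / (1 - real (Q - 1) * b)"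
proof -
  let ?q = "real (Q - 1) * b"
  \<comment> \<open>The inserted \<open>0\<close> keeps the maximum defined for empty
    \<open>F\<close>.\<close>
  define M where "M = Max (insert 0 ((\<lambda>x. d x y) ` F))"
  have M: "d x y \<le> M" if "x \<in> F" for x using F that by (auto simp: M_def)
  have layer: "real (card {x. d x y = Suc n}) * b ^ Suc n \<le> real Q * b * ?q ^ n" for n
  proof -
    have "real (card {x. d x y = Suc n}) * b ^ Suc n \<le> real (Q * (Q - 1) ^ n) * b ^ Suc n"
      using card_sphere(2)[of y n] b by (intro mult_right_mono) (auto simp del: of_nat_mult of_nat_power)
    then show ?thesis by (simp add: power_mult_distrib mult_ac)
  qed
  have 0: "card {x. d x y = 0} = 1"
  proof -
    have "{x. d x y = 0} = {y}" using d_eq_0 by auto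
    then show ?thesis by simp
  qed
  have "(\<Sum>x\<in>F. b ^ d x y) \<le> (\<Sum>x\<in>(\<Union>n\<le>M. {x. d x y = n}). b ^ d x y)"
    using M b(1) card_sphere(1) by (intro sum_mono2) auto
  also have "\<dots> = (\<Sum>n\<le>M. \<Sum>x | d x y = n. b ^ d x y)"
    by (rule sum.UNION_disjoint) (auto simp: card_sphere(1))
  also have "\<dots> = (\<Sum>n\<le>M. real (card {x. d x y = n}) * b ^ n)" by simp
  also have "\<dots> \<le> (\<Sum>n\<le>Suc M. real (card {x. d x y = n}) * b ^ n)"
    using b by simp
  also have "\<dots> = 1 + (\<Sum>n\<le>M. real (card {x. d x y = Suc n}) * b ^ Suc n)"
    unfolding sum.atMost_Suc_shift by (simp add: 0)
  also have "\<dots> \<le> 1 + (\<Sum>n\<le>M. real Q * b * ?q ^ n)"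
    by (intro add_left_mono sum_mono layer)
  also have "\<dots> = 1 + real Q * b * (\<Sum>n\<le>M. ?q ^ n)" by (simp add: sum_distrib_left)
  also have "(\<Sum>n\<le>M. ?q ^ n) \<le> (\<Sum>n. ?q ^ n)"
    using b by (intro sum_le_suminf summable_geometric) auto
  also have "(\<Sum>n. ?q ^ n) = 1 / (1 - ?q)"
    using b by (intro suminf_geometric) auto
  finally show ?thesis using b by (simp add: mult_left_mono)
qed

end

text \<open>\<open>U'\<close> is the kernel applied to \<open>U\<close>. The unit source at
  \<open>x\<close> becomes \<open>k v x\<close> at each \<open>v\<close>, and a nonzero natural
  number at \<open>y\<close> is at least one.\<close>

lemma (in nat_kernel) supersolution_neighbour:
  assumes U: "\<And>v. U v \<ge> 0" "\<And>v. (\<Sum>z | k v z \<noteq> 0. real (k v z) * U z) + (if v = x then 1 else 0) \<le> L * U v"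
    and y: "k y x \<noteq> 0"
  shows "\<exists>U'. (\<forall>v. U' v \<ge> 0) \<and>
    (\<forall>v. (\<Sum>z | k v z \<noteq> 0. real (k v z) * U' z) + (if v = y then 1 else 0) \<le> L * U' v)"
proof (intro exI conjI allI)
  define U' where "U' v = (\<Sum>z | k v z \<noteq> 0. real (k v z) * U z)" for v
  show "U' v \<ge> 0" for v unfolding U'_def using U(1) by (intro sum_nonneg) auto
  fix v
  have "(\<Sum>z | k v z \<noteq> 0. real (k v z) * U' z) + (if v = y then 1 else 0) \<le>
      (\<Sum>z | k v z \<noteq> 0. real (k v z) * U' z) + (\<Sum>z | k v z \<noteq> 0. real (k v z) * (if z = x then 1 else 0))"
  proof (rule add_left_mono)
    have "(\<Sum>z | k v z \<noteq> 0. real (k v z) * (if z = x then 1 else 0)) = real (k v x)"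
      using fin by (simp add: if_distrib sum.If_cases Int_def cong: if_cong)
    then show "(if v = y then 1 else 0) \<le> (\<Sum>z | k v z \<noteq> 0. real (k v z) * (if z = x then 1 else 0))"
      using y by auto
  qed
  also have "\<dots> = (\<Sum>z | k v z \<noteq> 0. real (k v z) * (U' z + (if z = x then 1 else 0)))"
    by (simp add: sum.distrib distrib_left)
  also have "\<dots> \<le> (\<Sum>z | k v z \<noteq> 0. real (k v z) * (L * U z))"
    using U(2) unfolding U'_def by (intro sum_mono mult_left_mono) auto
  also have "\<dots> = L * U' v" unfolding U'_def sum_distrib_left by (intro sum.cong) auto
  finally show "(\<Sum>z | k v z \<noteq> 0. real (k v z) * U' z) + (if v = y then 1 else 0) \<le> L * U' v" .
qed

section \<open>Adding loops to a graph\<close>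

lemma edge_count_add_loops:
  fixes G :: "('v, 'e) graph"
  assumes "finite {e \<in> edges G. ends G e = {x, y}}"
  shows "edge_count (add_loops G N) x y = edge_count G x y + (if x = y \<and> x \<in> N then 1 else 0)"
proof -
  have "{e \<in> edges (add_loops G N). ends (add_loops G N) e = {x, y}} =
      Inl ` {e \<in> edges G. ends G e = {x, y}} \<union> Inr ` {z \<in> N. {z} = {x, y}}"
  proof (rule set_eqI)
    fix e :: "'e + 'v"
    show "e \<in> {e \<in> edges (add_loops G N). ends (add_loops G N) e = {x, y}} \<longleftrightarrow>
        e \<in> Inl ` {e \<in> edges G. ends G e = {x, y}} \<union> Inr ` {z \<in> N. {z} = {x, y}}"
      by (cases e) (auto simp: add_loops_def image_iff Plus_def)
  qed
  then have "edge_count (add_loops G N) x y =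
      card (Inl ` {e \<in> edges G. ends G e = {x, y}} \<union> Inr ` {z \<in> N. {z} = {x, y}} :: ('e + 'v) set)"
    by (simp only: edge_count_def)
  also have "{z \<in> N. {z} = {x, y}} = (if x = y \<and> x \<in> N then {x} else {})" by auto
  finally show ?thesis
    using assms by (subst (asm) card_Un_disjoint) (auto simp: card_image edge_count_def)
qed

lemma valid_add_loops: "valid_graph G \<Longrightarrow> valid_graph (add_loops G N)"
  by (auto simp: valid_graph_def add_loops_def)

lemma connected_add_loops:
  assumes "graph_connected G"
  shows "graph_connected (add_loops G N)"
proof -
  have adj: "adjacent (add_loops G N) x y" if "adjacent G x y" for x y
    using that unfolding adjacent_def add_loops_def by force
  have "walk_betw (add_loops G N) x w y" if "walk_betw G x w y" for x w y
    using that successively_mono[of "adjacent G" w "adjacent (add_loops G N)"] adj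
    by (auto simp: walk_betw_def)
  then show ?thesis using assms unfolding graph_connected_def by metis
qed

context tree
begin

lemma edge_count_row:
  fixes f :: "'v \<Rightarrow> 'b::semiring_1"
  shows "{y. edge_count G x y \<noteq> 0} = nb x"
    and "(\<Sum>y | edge_count G x y \<noteq> 0. of_nat (edge_count G x y) * f y) = (\<Sum>y\<in>nb x. f y)"
proof -
  show row: "{y. edge_count G x y \<noteq> 0} = nb x" by (auto simp: edge_count_eq)
  show "(\<Sum>y | edge_count G x y \<noteq> 0. of_nat (edge_count G x y) * f y) = (\<Sum>y\<in>nb x. f y)"
    unfolding row by (simp add: edge_count_eq)
qed

lemma edge_count_loops_row:
  fixes f :: "'v \<Rightarrow> 'b::semiring_1" and N :: "'v set"
  defines "k \<equiv> edge_count (add_loops G N)"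
  shows "{y. k x y \<noteq> 0} = nb x \<union> (if x \<in> N then {x} else {})"
    and "(\<Sum>y | k x y \<noteq> 0. of_nat (k x y) * f y) = (\<Sum>y\<in>nb x. f y) + (if x \<in> N then f x else 0)"
    and "k x y = (if y \<in> nb x then 1 else 0) + (if x = y \<and> x \<in> N then 1 else 0)"
proof -
  have k: "k x y = (if y \<in> nb x then 1 else 0) + (if x = y \<and> x \<in> N then 1 else 0)" for x y
  proof -
    \<comment> \<open>\<open>card\<close> sends infinite sets to \<open>0\<close>, so counting one
      extra loop is correct once the old edges are known to be finitely many.\<close>
    have "finite {e \<in> edges G. ends G e = {x, y}}"
    proof (cases "{e \<in> edges G. ends G e = {x, y}} = {}")
      case False
      then obtain e where "e \<in> edges G" "ends G e = {x, y}" by auto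
      then have "{e \<in> edges G. ends G e = {x, y}} \<subseteq> {e}" by (auto intro: no_parallel)
      then show ?thesis by (rule finite_subset) simp
    qed (simp only: finite.emptyI)
    then show ?thesis unfolding k_def by (simp add: edge_count_add_loops edge_count_eq)
  qed
  show "k x y = (if y \<in> nb x then 1 else 0) + (if x = y \<and> x \<in> N then 1 else 0)" by (rule k)
  show row: "{y. k x y \<noteq> 0} = nb x \<union> (if x \<in> N then {x} else {})" by (auto simp: k)
  show "(\<Sum>y | k x y \<noteq> 0. of_nat (k x y) * f y) = (\<Sum>y\<in>nb x. f y) + (if x \<in> N then f x else 0)"
  proof -
    have "(\<Sum>y\<in>nb x. of_nat (k x y) * f y) = (\<Sum>y\<in>nb x. f y)"
      using no_loop[of x] by (intro sum.cong refl) (auto simp: k)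
    then show ?thesis
      unfolding row using no_loop[of x] finite_nb[of x]
      by (cases "x \<in> N") (simp_all add: k add.commute)
  qed
qed

end

section \<open>The Green function of the tree, parametrised by its decay rate
  \<open>a\<close>\<close>

locale green_parameter = tree Q G for Q :: nat and G :: "('v, 'e) graph" +
  fixes a :: real
  assumes a_pos: "0 < a" and a_less: "a < 1" and qa: "(real Q - 1) * a\<^sup>2 < 1"
begin

text \<open>Chosen so that the source in \<open>green_equation\<close> is exactly one:
  \<open>c * (1 / a - a) = 1\<close>.\<close>

definition c where "c = a / (1 - a\<^sup>2)"

text \<open>The value at which \<open>a ^ n\<close> solves the radial recurrence
  \<open>l * a ^ Suc n = a ^ n + (Q - 1) * a ^ Suc (Suc n)\<close> away from the source.\<close>

definition l where "l = 1 / a + (real Q - 1) * a"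

definition green :: "'v \<Rightarrow> 'v ell2" where
  "green y = Abs_ell2 (\<lambda>x. complex_of_real (c * a ^ d x y))"

lemma c_pos: "c > 0"
  using a_pos a_less by (simp add: c_def power_less_one_iff)

text \<open>The condition \<open>qa\<close> lets the decay of the squares beat the growth of
  spheres.\<close>

lemma coord_green: "coord (green y) x = complex_of_real (c * a ^ d x y)"
proof -
  have "(\<Sum>x\<in>F. (cmod (complex_of_real (c * a ^ d x y)))\<^sup>2) \<le>
      c\<^sup>2 * (1 + real Q * a\<^sup>2 / (1 - real (Q - 1) * a\<^sup>2))" if "finite F" for F
  proof -
    have "(\<Sum>x\<in>F. (cmod (complex_of_real (c * a ^ d x y)))\<^sup>2) = c\<^sup>2 * (\<Sum>x\<in>F. (a\<^sup>2) ^ d x y)"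
      by (simp add: norm_mult norm_power power_mult_distrib sum_distrib_left power_mult[symmetric] mult.commute
          abs_of_pos[OF a_pos])
    also have "\<dots> \<le> c\<^sup>2 * (1 + real Q * a\<^sup>2 / (1 - real (Q - 1) * a\<^sup>2))"
      using qa Q_ge by (intro mult_left_mono power_dist_sum_le that) (auto simp: of_nat_diff)
    finally show ?thesis .
  qed
  note bound = this
  show ?thesis unfolding green_def by (subst coord_Abs_ell2, rule bound) auto
qed

lemma green_equation:
  "l * (c * a ^ d x y) - (\<Sum>z\<in>nb x. c * a ^ d z y) = (if x = y then 1 else 0)"
proof (cases "x = y")
  case True
  have "l * c - real Q * a * c = c * (1 / a - a)" by (simp add: l_def algebra_simps)
  also have "\<dots> = 1"
  proof -
    have "a * a < 1" using a_pos a_less using mult_strict_mono[of a 1 a 1] by simp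
    then show ?thesis using a_pos by (simp add: c_def divide_simps power2_eq_square)
  qed
  finally show ?thesis using True by (simp add: sum_distrib_left[symmetric] nb_sum algebra_simps)
next
  case False
  then obtain n where n: "d x y = Suc n" using d_eq_0 by (metis not0_implies_Suc)
  have "l * a ^ Suc n = a ^ n + (real Q - 1) * a ^ Suc (Suc n)"
    using a_pos by (simp add: l_def field_simps)
  then have "c * (l * a ^ d x y - (\<Sum>z\<in>nb x. a ^ d z y)) = 0" using False n by (simp add: nb_sum)
  then show ?thesis using False by (simp add: sum_distrib_left[symmetric] algebra_simps)
qed

text \<open>\<open>1 / a\<close> and \<open>(Q - 1) * a\<close> have product \<open>Q - 1\<close>
  and differ by \<open>qa\<close>, so the arithmetic-geometric inequality is strict.\<close>

lemma l_ge: "l > 0" "l\<^sup>2 > 4 * (real Q - 1)"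
proof -
  show "l > 0" using a_pos Q_ge by (auto simp: l_def intro!: add_pos_nonneg)
  have "(real Q - 1) * a < 1 / a" using qa a_pos by (simp add: field_simps power2_eq_square)
  then have "(1 / a - (real Q - 1) * a)\<^sup>2 > 0" by simp
  moreover have "l\<^sup>2 = (1 / a - (real Q - 1) * a)\<^sup>2 + 4 * (real Q - 1)"
    using a_pos by (simp add: l_def field_simps power2_eq_square)
  ultimately show "l\<^sup>2 > 4 * (real Q - 1)" by simp
qed

end

context tree
begin

text \<open>The base of \<open>W_entry\<close> is the smaller root of
  \<open>(Q - 1) * a\<^sup>2 - lam * a + 1 = 0\<close>, which recovers the decay rate from the
  spectral value; the remaining factor is \<open>lam * c\<close>.\<close>

lemma green_parameter_root:
  fixes lam :: real
  assumes lam: "lam > 0" "lam\<^sup>2 > 4 * (real Q - 1)"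
  defines "a \<equiv> (1 - sqrt (1 - 4 * (real Q - 1) * (1 / lam)\<^sup>2)) / (2 * (real Q - 1) * (1 / lam))"
  shows "green_parameter Q G a" "green_parameter.l Q a = lam"
    "W_entry Q (1 / lam) n = lam * (green_parameter.c a * a ^ n)"
proof -
  define q where "q = real Q - 1"
  define s where "s = sqrt (1 - 4 * q * (1 / lam)\<^sup>2)"
  have q: "q \<ge> 1" using Q_ge by (simp add: q_def)
  have lt: "4 * q * (1 / lam)\<^sup>2 < 1" using lam by (simp add: q_def power_divide field_simps)
  have s2: "s\<^sup>2 = 1 - 4 * q / lam\<^sup>2" using lt by (simp add: s_def power_divide)
  have s: "0 < s" "s < 1" using lt q lam by (auto simp: s_def real_less_lsqrt)
  have aeq: "a = lam * (1 - s) / (2 * q)" by (simp add: a_def s_def q_def)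
  have a_pos: "a > 0" unfolding aeq using s lam q by auto
  have qa: "q * a = lam * (1 - s) / 2" using q by (simp add: aeq)
  have "q * a * (lam - q * a) = lam\<^sup>2 * (1 - s\<^sup>2) / 4"
    unfolding qa by (simp add: power2_eq_square field_simps)
  also have "\<dots> = q" unfolding s2 using lam by simp
  finally have "a * (lam - q * a) = 1" using q by (simp add: mult.assoc)
  then have inv: "1 / a = lam - q * a" using a_pos by (simp add: nonzero_divide_eq_eq mult.commute)
  then have inv': "1 / a = lam * (1 + s) / 2" unfolding qa by (simp add: field_simps)
  have "q * a < 1 / a" unfolding inv' qa using s lam by simp
  then have qa2: "q * a\<^sup>2 < 1" using a_pos by (simp add: field_simps power2_eq_square)
  have "a\<^sup>2 < 1" using mult_right_mono[OF q, of "a\<^sup>2"] qa2 by simp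
  then have a1: "a < 1" using a_pos by (simp add: power_less_one_iff abs_square_less_1)
  show gp: "green_parameter Q G a"
    using a_pos a1 qa2 by unfold_locales (auto simp: q_def)
  show "green_parameter.l Q a = lam"
    unfolding green_parameter.l_def[OF gp] using inv by (simp add: q_def)
  have ls: "lam * s = 1 / a - q * a" unfolding inv' qa by (simp add: field_simps)
  \<comment> \<open>Inserting \<open>lam = 1 / a + q * a\<close> and
    \<open>lam * s = 1 / a - q * a\<close> removes the square root from the denominator of
    \<open>W_entry\<close>.\<close>
  have "(real Q - 2 + real Q * s) * lam = (q - 1) * lam + (q + 1) * (lam * s)"
    by (simp add: q_def algebra_simps)
  also have "\<dots> = (q - 1) * (1 / a + q * a) + (q + 1) * (1 / a - q * a)"
    unfolding ls using inv by simp
  also have "\<dots> = 2 * q * (1 - a\<^sup>2) / a"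
    using a_pos by (simp add: field_simps power2_eq_square)
  finally have *: "(real Q - 2 + real Q * s) * lam = 2 * q * (1 - a\<^sup>2) / a" .
  moreover have "2 * q * (1 - a\<^sup>2) / a > 0" using q a_pos \<open>a\<^sup>2 < 1\<close> by simp
  ultimately have ne: "real Q - 2 + real Q * s \<noteq> 0" by auto
  have "2 * q / (real Q - 2 + real Q * s) = lam * (a / (1 - a\<^sup>2))"
    using * ne a_pos \<open>a\<^sup>2 < 1\<close> q lam by (simp add: field_simps)
  then show "W_entry Q (1 / lam) n = lam * (green_parameter.c a * a ^ n)"
    unfolding W_entry_def green_parameter.c_def[OF gp] a_def[symmetric]
    by (simp add: s_def q_def mult_ac)
qed

end

section \<open>The tree with loops along a path\<close>

text \<open>The smaller root of \<open>a\<^sup>2 - 3 * a + 1 = 0\<close>.\<close>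

definition a_star :: real where "a_star = (3 - sqrt 5) / 2"

lemma a_star_quadratic: "a_star\<^sup>2 = 3 * a_star - 1"
  by (simp add: a_star_def power2_eq_square field_simps)

text \<open>The bound \<open>7 / 18\<close> is what
  \<open>6 * a_star\<^sup>2 = 18 * a_star - 6 < 1\<close> requires, the case \<open>Q = 7\<close>;
  it amounts to \<open>sqrt 5 > 20 / 9\<close>.\<close>

lemma a_star_bounds: "0 < a_star" "a_star < 7 / 18" "1 / a_star = 3 - a_star"
proof -
  show pos: "0 < a_star" unfolding a_star_def by (simp add: real_less_lsqrt)
  have "sqrt 5 > 20 / 9" by (rule real_less_rsqrt) (simp add: power2_eq_square)
  then show "a_star < 7 / 18" unfolding a_star_def by simp
  have "a_star * (3 - a_star) = 1" using a_star_quadratic by (simp add: power2_eq_square algebra_simps)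
  then show "1 / a_star = 3 - a_star" using pos by (simp add: nonzero_divide_eq_eq mult.commute)
qed

text \<open>Two geometric series, one on each side of \<open>m\<close>; the conditional exponent is
  the absolute difference of \<open>m\<close> and \<open>n\<close>.\<close>

lemma sum_power_path:
  fixes a :: real
  shows "(1 - a) * (\<Sum>n<m + j. a ^ (if n \<le> m then m - n else n - m)) = a - a ^ Suc m + 1 - a ^ j"
proof (induction j)
  case 0
  show ?case
  proof (induction m)
    case (Suc m)
    define S where "S = (\<Sum>n<m. a ^ (if n \<le> m then m - n else n - m))"
    have "(\<Sum>n<Suc m. a ^ (if n \<le> Suc m then Suc m - n else n - Suc m)) = a * S + a"
      by (simp add: S_def sum_distrib_left Suc_diff_le)
    moreover have "(1 - a) * (a * S + a) = a - a ^ Suc (Suc m)"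
    proof -
      have IH: "(1 - a) * S = a - a ^ Suc m" using Suc by (simp add: S_def)
      have "(1 - a) * (a * S + a) = a * ((1 - a) * S) + (1 - a) * a" by (simp add: algebra_simps)
      then show ?thesis unfolding IH by (simp add: algebra_simps)
    qed
    ultimately show ?case by simp
  qed simp
next
  case (Suc j)
  define S where "S = (\<Sum>n<m + j. a ^ (if n \<le> m then m - n else n - m))"
  have "(\<Sum>n<m + Suc j. a ^ (if n \<le> m then m - n else n - m)) = S + a ^ j"
    by (cases j) (simp_all add: S_def)
  moreover have "(1 - a) * S = a - a ^ Suc m + 1 - a ^ j" using Suc by (simp only: S_def)
  moreover have "(1 - a) * (S + a ^ j) = (1 - a) * S + a ^ j - a ^ Suc j" by (simp add: algebra_simps)
  ultimately show ?case by simp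
qed

locale tree_path = tree Q G for Q :: nat and G :: "('v, 'e) graph" +
  fixes r :: 'v and p :: "nat \<Rightarrow> 'v"
  assumes Q_le: "Q \<le> 7" and path: "infinite_path_from G r p"
begin

abbreviation H where "H \<equiv> add_loops G (range p)"

abbreviation P where "P \<equiv> orthogonal_projection (ell2_on (range p))"

text \<open>Here \<open>Q \<le> 7\<close> enters: the decay at rate \<open>a_star\<close> has to
  beat the branching.\<close>

sublocale S: green_parameter Q G a_star
proof
  show "0 < a_star" "a_star < 1" using a_star_bounds by auto
  have "(real Q - 1) * a_star\<^sup>2 \<le> 6 * a_star\<^sup>2" using Q_le by (intro mult_right_mono) auto
  also have "\<dots> < 1" unfolding a_star_quadratic using a_star_bounds(2) by simp
  finally show "(real Q - 1) * a_star\<^sup>2 < 1" .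
qed

lemma l_star_eq: "S.l = (3 - sqrt 5) / 2 * real Q + sqrt 5"
  unfolding S.l_def a_star_bounds(3) by (simp add: a_star_def field_simps)

lemma inj_p: "inj p" and p_0: "p 0 = r"
  using path by (auto simp: infinite_path_from_def)

lemma d_p: "d (p n) (p m) = (if n \<le> m then m - n else n - m)"
  using path_dist[OF path, of n "m - n"] path_dist[OF path, of m "n - m"] d_commute[of "p n"] by auto

section \<open>The critical positive function \<open>h\<close>\<close>

definition h :: "'v \<Rightarrow> real" where "h x = (\<Sum>n. S.c * a_star ^ d x (p n))"

text \<open>The path is geodesic, so \<open>d x (p n)\<close> is at least \<open>n\<close> minus a
  constant depending on \<open>x\<close>, and a geometric series dominates.\<close>

lemma h_sums: "(\<lambda>n. S.c * a_star ^ d x (p n)) sums h x"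
proof -
  have "summable (\<lambda>n. S.c * a_star ^ d x (p n))"
  proof (rule summable_comparison_test')
    show "summable (\<lambda>n. S.c / a_star ^ d x (p 0) * a_star ^ n)"
      using S.a_pos S.a_less by (intro summable_mult summable_geometric) auto
    fix n :: nat assume "n \<ge> 0"
    have "n \<le> d x (p n) + d x (p 0)"
      using d_triangle[of "p 0" "p n" x] by (simp add: d_p d_commute add.commute)
    then have "a_star ^ (d x (p n) + d x (p 0)) \<le> a_star ^ n"
      using S.a_pos S.a_less by (intro power_decreasing) auto
    then have "a_star ^ d x (p n) \<le> a_star ^ n / a_star ^ d x (p 0)"
      using S.a_pos by (simp add: power_add pos_le_divide_eq)
    then have "S.c * a_star ^ d x (p n) \<le> S.c * (a_star ^ n / a_star ^ d x (p 0))"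
      using S.c_pos by (intro mult_left_mono) auto
    then show "norm (S.c * a_star ^ d x (p n)) \<le> S.c / a_star ^ d x (p 0) * a_star ^ n"
      using S.c_pos S.a_pos by simp
  qed
  then show ?thesis unfolding h_def by (rule summable_sums)
qed

lemma h_pos: "h x > 0"
  unfolding h_def using h_sums[of x, THEN sums_summable] S.c_pos S.a_pos by (intro suminf_pos) auto

text \<open>Termwise sum of the Green equations; injectivity of \<open>p\<close> makes the total
  source at a path vertex equal to one.\<close>

lemma h_equation: "S.l * h x - (\<Sum>z\<in>nb x. h z) = (if x \<in> range p then 1 else 0)"
proof -
  have "(\<lambda>n. S.l * (S.c * a_star ^ d x (p n)) - (\<Sum>z\<in>nb x. S.c * a_star ^ d z (p n))) sums
      (S.l * h x - (\<Sum>z\<in>nb x. h z))"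
    by (intro sums_diff sums_mult sums_sum h_sums)
  then have 1: "(\<lambda>n. if x = p n then 1 else 0) sums (S.l * h x - (\<Sum>z\<in>nb x. h z))"
    unfolding S.green_equation .
  have 2: "(\<lambda>n. if x = p n then 1 else (0::real)) sums (if x \<in> range p then 1 else 0)"
  proof (cases "x \<in> range p")
    case True
    then obtain m where m: "x = p m" by blast
    have "(\<lambda>n. if x = p n then 1 else (0::real)) = (\<lambda>n. if n = m then 1 else 0)"
      using m inj_p by (auto simp: fun_eq_iff inj_eq)
    then show ?thesis using True sums_single[of m "\<lambda>_. 1::real"] by simp
  next
    case False
    then have "(\<lambda>n. if x = p n then 1 else (0::real)) = (\<lambda>_. 0)" by (auto simp: fun_eq_iff)
    then show ?thesis using False by simp
  qed
  show ?thesis by (rule sums_unique2[OF 1 2])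
qed

text \<open>The equation \<open>(1 - a)\<^sup>2 = a\<close> singles out the critical parameter: it makes \<open>h\<close> tend to \<open>1\<close>
  along the path.\<close>

lemma c_star: "S.c * (1 + a_star) = 1 - a_star"
proof -
  have "a_star = (1 - a_star)\<^sup>2"
    using a_star_quadratic by (simp add: power2_diff)
  moreover have "1 - a_star\<^sup>2 = (1 - a_star) * (1 + a_star)" by (simp add: power2_eq_square algebra_simps)
  ultimately have "S.c = (1 - a_star)\<^sup>2 / ((1 - a_star) * (1 + a_star))" unfolding S.c_def by metis
  then show ?thesis using S.a_less S.a_pos by (simp add: power2_eq_square)
qed

text \<open>Kept for finite segments because the truncated sum is also the test vector in
  \<open>onorm_adjacency\<close>.\<close>

lemma path_sum:
  "(1 + a_star) * (\<Sum>n<m + j. S.c * a_star ^ d (p m) (p n)) = 1 + a_star - a_star ^ Suc m - a_star ^ j"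
proof -
  have "(1 + a_star) * (\<Sum>n<m + j. S.c * a_star ^ d (p m) (p n)) =
      S.c * (1 + a_star) * (\<Sum>n<m + j. a_star ^ (if n \<le> m then m - n else n - m))"
    unfolding sum_distrib_left by (intro sum.cong) (auto simp: d_p mult_ac)
  then show ?thesis unfolding c_star sum_power_path by simp
qed

text \<open>On a two-sided path \<open>h\<close> would be constantly one; the term
  \<open>a_star ^ Suc m\<close> is the contribution of the missing half.\<close>

lemma h_path: "(1 + a_star) * h (p m) = 1 + a_star - a_star ^ Suc m"
proof -
  have "(\<lambda>j. \<Sum>n<j + m. S.c * a_star ^ d (p m) (p n)) \<longlonglongrightarrow> h (p m)"
    using LIMSEQ_ignore_initial_segment[OF h_sums[of "p m", unfolded sums_def]] .
  then have "(\<lambda>j. (1 + a_star) * (\<Sum>n<m + j. S.c * a_star ^ d (p m) (p n))) \<longlonglongrightarrow> (1 + a_star) * h (p m)"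
    by (intro tendsto_mult_left) (simp only: add.commute)
  moreover have "(\<lambda>j. 1 + a_star - a_star ^ Suc m - a_star ^ j) \<longlonglongrightarrow> 1 + a_star - a_star ^ Suc m - 0"
    using S.a_pos S.a_less by (intro tendsto_diff tendsto_const LIMSEQ_power_zero) auto
  ultimately show ?thesis unfolding path_sum using LIMSEQ_unique by fastforce
qed

lemma h_path_less: "h (p m) < 1"
proof -
  have "(1 + a_star) * h (p m) < (1 + a_star) * 1" unfolding h_path using S.a_pos by simp
  then show ?thesis using S.a_pos by simp
qed

text \<open>The weight is shared with the looped graph, so both resolvents exist on the same range
  \<open>lam > S.l\<close>.\<close>

sublocale GK: nat_kernel "edge_count G" h S.l
proof
  fix x y
  show "edge_count G x y = edge_count G y x" by (simp add: edge_count_eq nb_sym)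
  show "finite {y. edge_count G x y \<noteq> 0}" unfolding edge_count_row(1) by (rule finite_nb)
  show "(\<Sum>y | edge_count G x y \<noteq> 0. real (edge_count G x y) * h y) \<le> S.l * h x"
    unfolding edge_count_row(2) using h_equation[of x] by (simp split: if_splits)
qed (auto simp: h_pos less_imp_le[OF S.l_ge(1)])

lemma h_equation_loops:
  "(\<Sum>y | edge_count H x y \<noteq> 0. real (edge_count H x y) * h y) =
    S.l * h x - (if x \<in> range p then 1 - h x else 0)"
  unfolding edge_count_loops_row(2) using h_equation[of x] by (simp split: if_splits)

text \<open>A loop adds \<open>h x\<close> at a path vertex, and the unit source in
  \<open>h_equation\<close> pays for it because \<open>h x < 1\<close> there.\<close>

sublocale HK: nat_kernel "edge_count H" h S.l
proof
  fix x y
  show "edge_count H x y = edge_count H y x" by (auto simp: edge_count_loops_row(3) nb_sym)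
  show "finite {y. edge_count H x y \<noteq> 0}" unfolding edge_count_loops_row(1) by (simp add: finite_nb)
  show "(\<Sum>y | edge_count H x y \<noteq> 0. real (edge_count H x y) * h y) \<le> S.l * h x"
    unfolding h_equation_loops using h_path_less by (auto simp: less_imp_le)
qed (auto simp: h_pos less_imp_le[OF S.l_ge(1)])

lemma GK_A: "GK.A = adjacency_operator G"
  by (simp add: GK.A_def adjacency_operator_def)

lemma HK_A: "HK.A = adjacency_operator H"
  by (simp add: HK.A_def adjacency_operator_def)

lemma coord_GK: "coord (GK.A f) x = (\<Sum>y\<in>nb x. coord f y)"
  unfolding GK.coord_A edge_count_row(2) ..

text \<open>The perturbation by loops is the projection itself, the form that Krein's formula
  expects.\<close>

lemma HK_A_eq: "HK.A f = GK.A f + P f"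
  by (rule ell2_eqI, unfold HK.coord_A edge_count_loops_row(2))
    (simp add: coord_GK coord_simps coord_orthogonal_projection_ell2_on)

lemma green_resolvent:
  assumes "green_parameter Q G a"
  shows "complex_of_real (green_parameter.l Q a) *\<^sub>C green_parameter.green G a y -
    GK.A (green_parameter.green G a y) = delta y"
proof (rule ell2_eqI)
  interpret T: green_parameter Q G a by (rule assms)
  fix x
  have "coord (complex_of_real T.l *\<^sub>C T.green y - GK.A (T.green y)) x =
      complex_of_real (T.l * (T.c * a ^ d x y) - (\<Sum>z\<in>nb x. T.c * a ^ d z y))"
    by (simp add: coord_simps coord_GK T.coord_green)
  then show "coord (complex_of_real T.l *\<^sub>C T.green y - GK.A (T.green y)) x = coord (delta y) x"
    unfolding T.green_equation by (simp add: delta.rep_eq)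
qed

section \<open>The resolvent formula at a fixed spectral value\<close>

context
  fixes lam :: real
  assumes lam: "S.l < lam"
begin

abbreviation "R\<^sub>G \<equiv> resolvent (adjacency_operator G) (complex_of_real lam)"
abbreviation "R\<^sub>H \<equiv> resolvent (adjacency_operator H) (complex_of_real lam)"

lemmas RG = GK.resolvent_right[OF lam, unfolded GK_A] GK.resolvent_eqI[OF lam, unfolded GK_A]
  GK.bounded_operator_resolvent[OF lam, unfolded GK_A]

lemmas RH = HK.resolvent_right[OF lam, unfolded HK_A] HK.resolvent_eqI[OF lam, unfolded HK_A]
  HK.bounded_operator_resolvent[OF lam, unfolded HK_A]

lemma
  shows W_operator_eq: "f \<in> ell2_on (range p) \<Longrightarrow>
      W_operator Q G (range p) (1 / lam) f = complex_of_real lam *\<^sub>C P (R\<^sub>G f)"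
    and W_has_matrix: "has_matrix (range p) (W_operator Q G (range p) (1 / lam)) (W_matrix Q G (1 / lam))"
proof -
  define a where "a = (1 - sqrt (1 - 4 * (real Q - 1) * (1 / lam)\<^sup>2)) / (2 * (real Q - 1) * (1 / lam))"
  have lam_pos: "lam > 0" using lam S.l_ge(1) by linarith
  have "S.l\<^sup>2 < lam\<^sup>2" using lam S.l_ge(1) by (intro power_strict_mono) auto
  then have "lam\<^sup>2 > 4 * (real Q - 1)" using S.l_ge(2) by linarith
  note root = green_parameter_root[OF lam_pos this, folded a_def]
  interpret T: green_parameter Q G a by (rule root(1))
  have green: "R\<^sub>G (delta y) = T.green y" for y
    by (rule RG(2)) (use green_resolvent[OF root(1), of y] root(2) in \<open>simp add: GK_A\<close>)
  have W_coord: "complex_of_real lam * coord (R\<^sub>G f) x = (\<Sum>\<^sub>\<infinity>y. W_matrix Q G (1 / lam) x y * coord f y)" for f x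
  proof -
    \<comment> \<open>Selfadjointness moves the resolvent onto \<open>delta x\<close>, where it is
      the Green function; no expansion of \<open>f\<close> is needed.\<close>
    have "coord (R\<^sub>G f) x = cinner (T.green x) f"
      using GK.resolvent_selfadjoint[OF lam, of "delta x" f]
      by (simp add: GK_A cinner_delta_left green)
    moreover have "(\<Sum>\<^sub>\<infinity>y. W_matrix Q G (1 / lam) x y * coord f y) =
        (\<Sum>\<^sub>\<infinity>y. complex_of_real lam * (cnj (coord (T.green x) y) * coord f y))"
      by (intro infsum_cong) (simp add: T.coord_green W_matrix_def root(3) d_commute[of x])
    ultimately show ?thesis by (simp only: infsum_cmult_right' cinner_def)
  qed
  show W: "W_operator Q G (range p) (1 / lam) f = complex_of_real lam *\<^sub>C P (R\<^sub>G f)"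
    if f: "f \<in> ell2_on (range p)" for f
  proof -
    have "(\<Sum>\<^sub>\<infinity>y\<in>range p. W_matrix Q G (1 / lam) x y * coord f y) = complex_of_real lam * coord (R\<^sub>G f) x" for x
      unfolding W_coord using f by (intro infsum_cong_neutral) (auto simp: ell2_on_iff)
    then have "(\<lambda>x. if x \<in> range p then \<Sum>\<^sub>\<infinity>y\<in>range p. W_matrix Q G (1 / lam) x y * coord f y else 0) =
        coord (complex_of_real lam *\<^sub>C P (R\<^sub>G f))"
      by (auto simp: fun_eq_iff coord_simps coord_orthogonal_projection_ell2_on)
    then show ?thesis unfolding W_operator_def matrix_operator_def by (simp only: coord_inverse)
  qed
  have "bounded_operator_on (ell2_on (range p)) (W_operator Q G (range p) (1 / lam))"
    by (rule bounded_operator_compression[OF RG(3), of _ _ 0 "complex_of_real lam"])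
      (auto simp: W intro!: ell2_eqI simp: coord_simps)
  moreover have "cinner (delta x) (W_operator Q G (range p) (1 / lam) (delta y)) = W_matrix Q G (1 / lam) x y"
    if "x \<in> range p" "y \<in> range p" for x y
  proof -
    have "delta y \<in> ell2_on (range p)" using that by (auto simp: ell2_on_iff delta.rep_eq)
    then show ?thesis
      using that(1) by (simp add: W cinner_delta_left coord_simps coord_orthogonal_projection_ell2_on
          green T.coord_green W_matrix_def root(3))
  qed
  ultimately show "has_matrix (range p) (W_operator Q G (range p) (1 / lam)) (W_matrix Q G (1 / lam))"
    unfolding has_matrix_def by blast
qed

text \<open>Each follows from uniqueness of solutions of the shifted equation, after trading one
  adjacency operator for the other by \<open>HK_A_eq\<close>.\<close>

lemma resolvent_identities:
  "R\<^sub>H g = R\<^sub>G g + R\<^sub>G (P (R\<^sub>H g))" "R\<^sub>H g = R\<^sub>G g + R\<^sub>H (P (R\<^sub>G g))"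
proof -
  have sum: "R\<^sub>G (f + g) = R\<^sub>G f + R\<^sub>G g" "R\<^sub>H (f + g) = R\<^sub>H f + R\<^sub>H g" for f g
    using bounded_operator_onD(2)[OF RG(3)] bounded_operator_onD(2)[OF RH(3)] by auto
  have "complex_of_real lam *\<^sub>C R\<^sub>H g - adjacency_operator G (R\<^sub>H g) = g + P (R\<^sub>H g)"
    using RH(1)[of g] HK_A_eq[of "R\<^sub>H g"] by (simp add: HK_A GK_A algebra_simps)
  from RG(2)[OF this] show "R\<^sub>H g = R\<^sub>G g + R\<^sub>G (P (R\<^sub>H g))" by (simp add: sum)
  have "complex_of_real lam *\<^sub>C R\<^sub>G g - adjacency_operator H (R\<^sub>G g) = g - P (R\<^sub>G g)"
    using RG(1)[of g] HK_A_eq[of "R\<^sub>G g"] by (simp add: HK_A GK_A algebra_simps)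
  from RH(2)[OF this] show "R\<^sub>H g = R\<^sub>G g + R\<^sub>H (P (R\<^sub>G g))"
    by (metis diff_add_cancel sum(2))
qed

lemma resolvent_formula:
  defines "D \<equiv> \<lambda>g. g - complex_of_real (1 / lam) *\<^sub>C W_operator Q G (range p) (1 / lam) g"
  shows "invertible_on (ell2_on (range p)) D"
    and "R\<^sub>H f = R\<^sub>G (f + P (inv_into (ell2_on (range p)) D (P (R\<^sub>G f))))"
proof -
  have lam_pos: "lam > 0" using lam S.l_ge(1) by linarith
  have D: "D g = g - P (R\<^sub>G g)" if "g \<in> ell2_on (range p)" for g
    unfolding D_def W_operator_eq[OF that] using lam_pos
    by (intro ell2_eqI) (simp add: coord_simps)
  show "invertible_on (ell2_on (range p)) D"
    by (rule krein_invertible[OF RG(3) RH(3) resolvent_identities D])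
  show "R\<^sub>H f = R\<^sub>G (f + P (inv_into (ell2_on (range p)) D (P (R\<^sub>G f))))"
    by (rule krein_formula[OF RG(3) RH(3) resolvent_identities D])
qed

end

text \<open>For the lower bound, test with \<open>v = \<Sum>n<M. green (p n)\<close>: the form \<open>\<langle>(\<lambda>\<^sub>* - A\<^sub>H) v, v\<rangle>\<close> stays
  bounded in \<open>M\<close>, because \<open>v\<close> differs from \<open>1\<close> only near the two ends of the segment, while the
  norm of \<open>v\<close> tends to infinity.\<close>

lemma onorm_adjacency: "onorm (adjacency_operator H) = S.l"
proof (rule antisym)
  show "onorm (adjacency_operator H) \<le> S.l"
    unfolding HK_A[symmetric] by (rule onorm_bound) (auto simp: HK.norm_A_le less_imp_le[OF S.l_ge(1)])
  show "S.l \<le> onorm (adjacency_operator H)"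
  proof (rule ccontr)
    define K where "K = onorm (adjacency_operator H)"
    assume "\<not> S.l \<le> onorm (adjacency_operator H)"
    then have K: "K < S.l" by (simp add: K_def)
    have norm_le: "norm (HK.A f) \<le> K * norm f" for f
      unfolding K_def HK_A[symmetric] by (rule onorm[OF HK.bounded_linear_A])
    \<comment> \<open>Twice a geometric series, one for the defect \<open>1 - w\<close> at each end
      of the segment.\<close>
    define C where "C = 2 / (1 - a_star)"
    have bound: "(S.l - K) * (S.c\<^sup>2 * real M) \<le> C" for M
    proof -
      define v where "v = (\<Sum>n<M. S.green (p n))"
      define w where "w x = (\<Sum>n<M. S.c * a_star ^ d x (p n))" for x
      have coord_v: "coord v x = complex_of_real (w x)" for x
        by (simp add: v_def w_def coord_sum S.coord_green)
      have w_ge: "w (p m) \<ge> S.c" if "m < M" for m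
      proof -
        have "S.c * a_star ^ d (p m) (p m) \<le> w (p m)"
          unfolding w_def using that S.c_pos S.a_pos
          by (intro member_le_sum[of m "{..<M}" "\<lambda>n. S.c * a_star ^ d (p m) (p n)"]) auto
        then show ?thesis by simp
      qed
      \<comment> \<open>The exponents are lowered by one so that reversing the summation index turns
        the second power into the first.\<close>
      have w_defect: "1 - w (p m) \<le> a_star ^ m + a_star ^ (M - Suc m)" if "m < M" for m
      proof -
        have "(1 + a_star) * w (p m) = 1 + a_star - a_star ^ Suc m - a_star ^ (M - m)"
          using path_sum[of m "M - m"] that by (simp add: w_def)
        moreover have "a_star ^ Suc m \<le> a_star ^ m" "a_star ^ (M - m) \<le> a_star ^ (M - Suc m)"
          using S.a_pos S.a_less by (auto intro!: power_decreasing)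
        ultimately have "(1 + a_star) * (1 - w (p m)) \<le> a_star ^ m + a_star ^ (M - Suc m)"
          by (simp add: algebra_simps)
        also have "\<dots> \<le> (1 + a_star) * (a_star ^ m + a_star ^ (M - Suc m))"
          using S.a_pos by (simp add: algebra_simps)
        finally show ?thesis using S.a_pos by simp
      qed
      have Av: "HK.A v = complex_of_real S.l *\<^sub>C v - (\<Sum>n<M. delta (p n)) + P v"
      proof (rule ell2_eqI)
        fix x
        have "coord (GK.A v) x = complex_of_real (\<Sum>n<M. \<Sum>z\<in>nb x. S.c * a_star ^ d z (p n))"
          unfolding coord_GK coord_v w_def by (subst sum.swap) simp
        also have "(\<Sum>n<M. \<Sum>z\<in>nb x. S.c * a_star ^ d z (p n)) =
            (\<Sum>n<M. S.l * (S.c * a_star ^ d x (p n)) - (if x = p n then 1 else 0))"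
          by (simp only: S.green_equation[symmetric]) simp
        also have "complex_of_real \<dots> = complex_of_real S.l * coord v x - (\<Sum>n<M. coord (delta (p n)) x)"
          by (simp add: sum_subtractf coord_v w_def sum_distrib_left delta.rep_eq, rule sum.cong) auto
        finally show "coord (HK.A v) x = coord (complex_of_real S.l *\<^sub>C v - (\<Sum>n<M. delta (p n)) + P v) x"
          by (simp add: HK_A_eq coord_simps coord_sum)
      qed
      have "cinner (P v) v = cinner (P v) (P v)"
        unfolding cinner_def by (intro infsum_cong) (simp add: coord_orthogonal_projection_ell2_on)
      then have "inner (P v) v = (norm (P v))\<^sup>2"
        by (simp add: inner_ell2_def power2_norm_eq_inner)
      moreover have "(\<Sum>m<M. (w (p m))\<^sup>2) \<le> (norm (P v))\<^sup>2"
      proof -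
        have "(\<Sum>m<M. (w (p m))\<^sup>2) = (\<Sum>x\<in>p ` {..<M}. (cmod (coord (P v) x))\<^sup>2)"
          using inj_p by (subst sum.reindex)
            (auto simp: inj_on_def coord_orthogonal_projection_ell2_on coord_v dest: injD)
        then show ?thesis using ell2_finite_sum_le[of "p ` {..<M}" "P v"] by simp
      qed
      moreover have "inner (\<Sum>n<M. delta (p n)) v = (\<Sum>n<M. w (p n))"
        unfolding inner_sum_left by (simp add: inner_ell2_def cinner_delta_left coord_v)
      moreover have "inner (HK.A v) v = S.l * (norm v)\<^sup>2 - inner (\<Sum>n<M. delta (p n)) v + inner (P v) v"
        unfolding Av scaleC_of_real by (simp add: inner_diff_left inner_add_left power2_norm_eq_inner)
      moreover have "inner (HK.A v) v \<le> K * (norm v)\<^sup>2"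
      proof -
        have "inner (HK.A v) v \<le> norm (HK.A v) * norm v" by (rule norm_cauchy_schwarz)
        also have "\<dots> \<le> K * norm v * norm v" by (intro mult_right_mono norm_le) auto
        finally show ?thesis by (simp add: power2_eq_square mult.assoc)
      qed
      \<comment> \<open>In the quadratic form the source contributes the sum of \<open>w\<close> and
        the loops at least the sum of its squares; their difference controls the supposed gap
        \<open>S.l - K\<close>.\<close>
      ultimately have "(S.l - K) * (norm v)\<^sup>2 \<le> (\<Sum>m<M. w (p m)) - (\<Sum>m<M. (w (p m))\<^sup>2)"
        by (simp add: algebra_simps)
      also have "\<dots> = (\<Sum>m<M. w (p m) - (w (p m))\<^sup>2)" by (simp add: sum_subtractf)
      also have "\<dots> \<le> (\<Sum>m<M. 1 - w (p m))"
      proof (rule sum_mono)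
        fix m
        have "0 \<le> (1 - w (p m))\<^sup>2" by simp
        then show "w (p m) - (w (p m))\<^sup>2 \<le> 1 - w (p m)" by (simp add: power2_diff)
      qed
      also have "\<dots> \<le> (\<Sum>m<M. a_star ^ m + a_star ^ (M - Suc m))"
        by (intro sum_mono w_defect) auto
      also have "\<dots> = 2 * (\<Sum>m<M. a_star ^ m)"
        using sum.nat_diff_reindex[of "\<lambda>m. a_star ^ m" M] by (simp add: sum.distrib)
      also have "\<dots> \<le> 2 * (\<Sum>m. a_star ^ m)"
        using S.a_pos S.a_less by (intro mult_left_mono sum_le_suminf summable_geometric) auto
      also have "\<dots> = C"
        using S.a_pos S.a_less by (simp add: C_def suminf_geometric)
      finally have "(S.l - K) * (norm v)\<^sup>2 \<le> C" .
      \<comment> \<open>Each of the \<open>M\<close> segment vertices contributes at least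
        \<open>S.c\<^sup>2\<close>, so the norm outgrows the constant \<open>C\<close>.\<close>
      moreover have "S.c\<^sup>2 * real M \<le> (norm v)\<^sup>2"
      proof -
        have "S.c\<^sup>2 * real M = (\<Sum>m<M. S.c\<^sup>2)" by simp
        also have "\<dots> \<le> (\<Sum>m<M. (w (p m))\<^sup>2)"
          using w_ge S.c_pos by (intro sum_mono power_mono) auto
        also have "\<dots> = (\<Sum>x\<in>p ` {..<M}. (cmod (coord v x))\<^sup>2)"
          using inj_p by (subst sum.reindex) (auto simp: inj_on_def coord_v dest: injD)
        also have "\<dots> \<le> (norm v)\<^sup>2" by (rule ell2_finite_sum_le) simp
        finally show ?thesis .
      qed
      ultimately show ?thesis using K by (meson diff_gt_0_iff_gt mult_left_mono less_imp_le order_trans)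
    qed
    have "(S.l - K) * S.c\<^sup>2 > 0" using K S.c_pos by simp
    then obtain M :: nat where "C < real M * ((S.l - K) * S.c\<^sup>2)" using ex_less_of_nat_mult by blast
    with bound[of M] show False by (simp add: mult_ac)
  qed
qed

section \<open>Supersolutions and transience\<close>

lemma supersolution:
  "\<exists>U. (\<forall>v. U v \<ge> 0) \<and>
    (\<forall>v. (\<Sum>z | edge_count H v z \<noteq> 0. real (edge_count H v z) * U z) + (if v = x then 1 else 0) \<le> S.l * U v)"
    (is "?super x")
proof -
  have root: "?super r"
  proof (intro exI conjI allI)
    \<comment> \<open>Dividing \<open>h\<close> by its strictly positive defect at the root creates
      a unit source there.\<close>
    have t: "1 - h r > 0" using h_path_less[of 0] p_0 by simp
    fix v
    show "h v / (1 - h r) \<ge> 0" using t h_pos[of v] by simp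
    have "(\<Sum>z | edge_count H v z \<noteq> 0. real (edge_count H v z) * (h z / (1 - h r))) =
        (S.l * h v - (if v \<in> range p then 1 - h v else 0)) / (1 - h r)"
      unfolding h_equation_loops[symmetric] sum_divide_distrib by simp
    moreover have "(if v = r then 1 else 0) \<le> (if v \<in> range p then 1 - h v else 0) / (1 - h r)"
      using t h_path_less p_0 by (auto simp: less_imp_le)
    ultimately show "(\<Sum>z | edge_count H v z \<noteq> 0. real (edge_count H v z) * (h z / (1 - h r))) +
        (if v = r then 1 else 0) \<le> S.l * (h v / (1 - h r))"
      by (simp add: diff_divide_distrib)
  qed
  \<comment> \<open>The source is carried along a walk from the root to \<open>x\<close>.\<close>
  have step: "?super y" if "?super x" "y \<in> nb x" for x y
  proof -
    have "edge_count H y x \<noteq> 0" using that(2) nb_sym by (simp add: edge_count_loops_row(3))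
    then show ?thesis using that(1) HK.supersolution_neighbour by blast
  qed
  have "?super (last w)" if "w \<noteq> []" "successively (adjacent G) w" "?super (hd w)" for w
    using that
  proof (induction w rule: induct_list012)
    case (3 x y w)
    then show ?case using step[of x y] by (simp add: nb_iff)
  qed auto
  moreover obtain w where "walk_betw G r w x" using connected by blast
  ultimately show ?thesis using root unfolding walk_betw_def by blast
qed

text \<open>\<open>recurrent\<close> asks for divergence at some vertex, so every vertex has to be
  refuted; \<open>U x\<close> bounds the diagonal resolvent entry uniformly down to the
  norm.\<close>

lemma transient_H: "transient H"
proof -
  have G: "valid_graph G" "graph_connected G" using tree by (auto simp: homogeneous_tree_def)
  have "\<not> recurrent H"
  proof
    assume "recurrent H"
    then obtain x where lim: "filterlim (\<lambda>l. Re (cinner (resolvent HK.A (complex_of_real l) (delta x)) (delta x)))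
        at_top (at_right S.l)"
      unfolding recurrent_def Let_def onorm_adjacency HK_A by blast
    obtain U where U: "\<And>v. U v \<ge> 0" "\<And>v. (\<Sum>z | edge_count H v z \<noteq> 0. real (edge_count H v z) * U z) +
        (if v = x then 1 else 0) \<le> S.l * U v"
      using supersolution[of x] by blast
    have "\<forall>\<^sub>F l in at_right S.l. U x < Re (cinner (resolvent HK.A (complex_of_real l) (delta x)) (delta x))"
      using lim unfolding filterlim_at_top_dense by blast
    moreover have "\<forall>\<^sub>F l in at_right S.l. S.l < l" by (rule eventually_at_right_less)
    ultimately have "\<forall>\<^sub>F l in at_right S.l. False"
    proof eventually_elim
      case (elim l)
      then show False
        using HK.resolvent_delta_le[OF elim(2) U, of x] by (simp add: cinner_delta_right)
    qed
    then show False by simp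
  qed
  then show ?thesis
    unfolding transient_def using valid_add_loops connected_add_loops G HK.bounded_selfadjoint_A HK_A by metis
qed

end

theorem theorem5p3:
  fixes Q :: nat and G :: "('v, 'e) graph" and r :: 'v and p :: "nat \<Rightarrow> 'v"
  assumes "2 \<le> Q" and "Q \<le> 7"
    and "homogeneous_tree Q G"
    and "infinite_path_from G r p"
  shows
    "let N = range p;
         H = add_loops G N;
         A\<^sub>G = adjacency_operator G;
         A\<^sub>H = adjacency_operator H;
         P = orthogonal_projection (ell2_on N)
     in
       has_matrix UNIV A\<^sub>G (\<lambda>x y. of_nat (edge_count G x y)) \<and>
       has_matrix UNIV A\<^sub>H (\<lambda>x y. of_nat (edge_count H x y)) \<and>
       (\<forall>lam::real. lam > (3 - sqrt 5) / 2 * real Q + sqrt 5 \<longrightarrow>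
          (let W = W_operator Q G N (1 / lam);
               D = (\<lambda>g. g - complex_of_real (1 / lam) *\<^sub>C W g);
               R\<^sub>G = resolvent A\<^sub>G (complex_of_real lam);
               R\<^sub>H = resolvent A\<^sub>H (complex_of_real lam)
           in
             has_matrix N W (W_matrix Q G (1 / lam)) \<and>
             in_resolvent_set A\<^sub>G (complex_of_real lam) \<and>
             in_resolvent_set A\<^sub>H (complex_of_real lam) \<and>
             invertible_on (ell2_on N) D \<and>
             (\<forall>f. R\<^sub>H f = R\<^sub>G (f + P (inv_into (ell2_on N) D (P (R\<^sub>G f)))))))
       \<and> transient H"
proof -
  interpret tree_path Q G r p
    using assms by unfold_locales
  show ?thesis
    unfolding Let_def
    using GK.has_matrix_A HK.has_matrix_A transient_H W_has_matrix resolvent_formula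
      GK.in_resolvent_set_A HK.in_resolvent_set_A
    unfolding GK_A HK_A l_star_eq by blast
qed

end
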